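(* For every integer $n\ge1$, \[\|C_n\|_{l^2}=\sum_{(\epsilon_1,\ldots,\epsilon_{2n})\in\{0,1\}^{2n}} \bigl(C_n(\epsilon_1,\ldots,\epsilon_{2n})\bigr)^2\] equals the number of domino tilings of the Aztec diamond $AD(n)$, and $\|C_n\|_{l^2}=2^{n(n+1)/2}$.
   Context: The Aztec diamond $AD(n)$ is the union of all unit lattice squares $[i,i+1]\times[j,j+1]$ ($i,j\in\mathbb{Z}$) contained in the region $|x|+|y|\le n+1$; a domino tiling covers it by $1\times2$ or $2\times1$ dominoes without gaps or overlaps. For $m\ge1$, $\mathbb{Z}\langle\{0,1\}^m\rangle$ is the free abelian group with basis the binary sequences of length $m$; maps on basis elements are extended $\mathbb{Z}$-linearly, and a function $\{0,1\}^m\to\mathbb{Z}_{\ge0}$ extends to a homomorphism to $\mathbb{Z}$. (i) $R_m(\epsilon_1,\ldots,\epsilon_m)=(1-\epsilon_1,\ldots,1-\epsilon_m)$. (ii) For $m\ge2$, $1\le i\le m-1$: $E_m^i(\epsilon)=\epsilon+\epsilon'$ if $(\epsilon_i,\epsilon_{i+1})=(0,0)$, with $\epsilon'$ equal to $\epsilon$ with entries $i,i+1$ replaced by $1,1$; $E_m^i(\epsilon)=\epsilon$ otherwise. $E_m=E_m^{m-1}\circ\cdots\circ E_m^1$. (iii) For $m\ge4$, $K_m:\mathbb{Z}\langle\{0,1\}^m\rangle\to\mathbb{Z}\langle\{0,1\}^{m-2}\rangle$: $K_m(\epsilon)=0$ if $(\epsilon_1,\epsilon_2)=(0,1)$ or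 $(\epsilon_{m-1},\epsilon_m)=(1,0)$; otherwise $K_m(\epsilon)=(a,\epsilon_3,\ldots,\epsilon_{m-2},b)$ with $a=0$ if $(\epsilon_1,\epsilon_2)=(1,0)$, $a=1$ if $(\epsilon_1,\epsilon_2)\in\{(0,0),(1,1)\}$, $b=0$ if $(\epsilon_{m-1},\epsilon_m)=(0,1)$, $b=1$ if $(\epsilon_{m-1},\epsilon_m)\in\{(0,0),(1,1)\}$. (iv) $C_1(0,0)=C_1(1,1)=1$, $C_1(0,1)=C_1(1,0)=0$; for $n\ge2$, $C_n:\{0,1\}^{2n}\to\mathbb{Z}_{\ge0}$ is $C_n=C_{n-1}\circ R_{2n-2}\circ E_{2n-2}\circ K_{2n}$. *)

theory Defs
  imports "HOL-Analysis.Analysis" "HOL-Library.Poly_Mapping"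
begin

text \<open>
  Binary sequences are Boolean lists, with \<^const>\<open>False\<close> for 0 and \<^const>\<open>True\<close> for 1; the
  entry \<open>\<epsilon>\<^sub>i\<close> (counted from 1) is \<open>\<epsilon> ! (i - 1)\<close>. The free abelian group on the sequences of
  length \<open>m\<close> is the subgroup of \<^typ>\<open>bool list \<Rightarrow>\<^sub>0 int\<close> supported on \<open>binseq m\<close>. The maps below
  are \<^const>\<open>frag_extend\<close>s, i.e. linear extensions, of maps on basis elements; an operator with
  index \<open>m\<close> is only meaningful on elements supported on \<open>binseq m\<close>.
\<close>

definition binseq :: "nat \<Rightarrow> bool list set" where
  "binseq m = {\<epsilon>. length \<epsilon> = m}"

definition lin_extend :: "('a \<Rightarrow> int) \<Rightarrow> ('a \<Rightarrow>\<^sub>0 int) \<Rightarrow> int" where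
  "lin_extend f x = (\<Sum>a\<in>Poly_Mapping.keys x. Poly_Mapping.lookup x a * f a)"

text \<open>The complementation does not depend on the length.\<close>

definition R_op :: "(bool list \<Rightarrow>\<^sub>0 int) \<Rightarrow> (bool list \<Rightarrow>\<^sub>0 int)" where
  "R_op = frag_extend (\<lambda>\<epsilon>. frag_of (map Not \<epsilon>))"

definition Ei_basis :: "nat \<Rightarrow> bool list \<Rightarrow> (bool list \<Rightarrow>\<^sub>0 int)" where
  "Ei_basis i \<epsilon> =
     (if \<not> \<epsilon> ! (i - 1) \<and> \<not> \<epsilon> ! i
      then frag_of \<epsilon> + frag_of (\<epsilon>[i - 1 := True, i := True])
      else frag_of \<epsilon>)"

definition Ei_op :: "nat \<Rightarrow> (bool list \<Rightarrow>\<^sub>0 int) \<Rightarrow> (bool list \<Rightarrow>\<^sub>0 int)" where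
  "Ei_op i = frag_extend (Ei_basis i)"

text \<open>The operator with \<open>i = 1\<close> is applied first, the one with \<open>i = m - 1\<close> last.\<close>

definition E_op :: "nat \<Rightarrow> (bool list \<Rightarrow>\<^sub>0 int) \<Rightarrow> (bool list \<Rightarrow>\<^sub>0 int)" where
  "E_op m = fold Ei_op [1..<m]"

text \<open>
  Outside the two vanishing cases, the first new entry is 0 iff \<open>(\<epsilon>\<^sub>1, \<epsilon>\<^sub>2) = (1, 0)\<close> and the last
  one is 0 iff \<open>(\<epsilon>\<^sub>m\<^sub>-\<^sub>1, \<epsilon>\<^sub>m) = (0, 1)\<close>.
\<close>

definition K_basis :: "nat \<Rightarrow> bool list \<Rightarrow> (bool list \<Rightarrow>\<^sub>0 int)" where
  "K_basis m \<epsilon> =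
     (let l = (\<epsilon> ! 0, \<epsilon> ! 1); r = (\<epsilon> ! (m - 2), \<epsilon> ! (m - 1)) in
      if l = (False, True) \<or> r = (True, False) then 0
      else frag_of ([l \<noteq> (True, False)] @ take (m - 4) (drop 2 \<epsilon>) @ [r \<noteq> (False, True)]))"

definition K_op :: "nat \<Rightarrow> (bool list \<Rightarrow>\<^sub>0 int) \<Rightarrow> (bool list \<Rightarrow>\<^sub>0 int)" where
  "K_op m = frag_extend (K_basis m)"

text \<open>
  Only \<open>C n\<close> on \<open>binseq (2 * n)\<close> with \<open>n \<ge> 1\<close> is meaningful; the value at \<open>n = 0\<close> is a dummy.
  The values are integers for uniformity with \<^const>\<open>lin_extend\<close>; they are shown to be
  nonnegative in \<open>C_nonneg\<close>.
\<close>

fun C :: "nat \<Rightarrow> bool list \<Rightarrow> int" where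
  "C 0 \<epsilon> = 0"
| "C (Suc 0) \<epsilon> = (if \<epsilon> ! 0 = \<epsilon> ! 1 then 1 else 0)"
| "C (Suc (Suc k)) \<epsilon> =
     (let n = k + 2 in
      lin_extend (C (Suc k)) (R_op (E_op (2 * n - 2) (K_op (2 * n) (frag_of \<epsilon>)))))"

definition l2_norm :: "nat \<Rightarrow> (bool list \<Rightarrow> int) \<Rightarrow> int" where
  "l2_norm m f = (\<Sum>\<epsilon>\<in>binseq m. (f \<epsilon>)\<^sup>2)"

definition unit_square :: "int \<Rightarrow> int \<Rightarrow> (real \<times> real) set" where
  "unit_square i j = {of_int i..of_int i + 1} \<times> {of_int j..of_int j + 1}"

definition aztec_diamond :: "nat \<Rightarrow> (real \<times> real) set" where
  "aztec_diamond n =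
     \<Union>{unit_square i j | i j. unit_square i j \<subseteq> {(x, y). \<bar>x\<bar> + \<bar>y\<bar> \<le> real n + 1}}"

definition dominoes :: "(real \<times> real) set set" where
  "dominoes =
     {unit_square i j \<union> unit_square (i + 1) j | i j. True} \<union>
     {unit_square i j \<union> unit_square i (j + 1) | i j. True}"

text \<open>
  \<open>T division_of S\<close> says that the finitely many boxes in \<open>T\<close> have pairwise disjoint interiors
  and union \<open>S\<close>.
\<close>

definition domino_tilings :: "(real \<times> real) set \<Rightarrow> (real \<times> real) set set set" where
  "domino_tilings S = {T. T \<subseteq> dominoes \<and> T division_of S}"

lemma nonneg_frag_extend:
  assumes "\<And>a b. 0 \<le> Poly_Mapping.lookup (f a) b" "\<And>a. 0 \<le> Poly_Mapping.lookup x a"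
  shows "0 \<le> Poly_Mapping.lookup (frag_extend f x) b"
  using assms by (simp add: frag_extend_def lookup_sum sum_nonneg)

lemma C_nonneg: "0 \<le> C n \<epsilon>"
proof (induction n \<epsilon> rule: C.induct)
  case (3 k \<epsilon>)
  have Ei: "0 \<le> Poly_Mapping.lookup (Ei_op i x) b" if "\<And>a. 0 \<le> Poly_Mapping.lookup x a" for i x b
    unfolding Ei_op_def
    by (rule nonneg_frag_extend) (auto simp: Ei_basis_def lookup_add that)
  have fold: "0 \<le> Poly_Mapping.lookup (fold Ei_op is x) b"
    if "\<And>a. 0 \<le> Poly_Mapping.lookup x a" for "is" x b
    using that by (induction "is" arbitrary: x) (auto intro: Ei)
  have "0 \<le> Poly_Mapping.lookup (K_op m (frag_of \<epsilon>)) b" for m b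
    unfolding K_op_def by (rule nonneg_frag_extend) (auto simp: K_basis_def Let_def)
  then have "0 \<le> Poly_Mapping.lookup (R_op (E_op m' (K_op m (frag_of \<epsilon>)))) b" for m m' b
    unfolding R_op_def E_op_def by (intro nonneg_frag_extend fold) auto
  then show ?case
    using 3 by (auto simp: lin_extend_def Let_def intro!: sum_nonneg)
qed auto

end

theory Submission
  imports Defs
begin


text \<open>
  \<^bold>\<open>Tilings and \<open>C\<close>.\<close> Cut \<open>AD(n)\<close> along the horizontal axis. Then \<open>C n \<epsilon>\<close> is the number of
  tilings of one half in which the cell \<open>i\<close> of the row at the cut is already covered from outside
  iff \<open>\<epsilon>\<^sub>i = 1\<close>: scanning that row from left to right, \<open>K\<close> treats the two end cells, which have no
  neighbour in the next row, \<open>E\<close> places the horizontal dominoes, and \<open>R\<close> marks the cells of the next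
  row covered by the vertical dominoes starting at the uncovered cells. Summing over the set of
  vertical dominoes crossing the cut, the number of tilings is \<open>\<Sum>\<^sub>\<epsilon> C n \<epsilon> * C n \<epsilon>\<close>.

  \<^bold>\<open>Number of tilings.\<close> This is domino shuffling in static form. Consider the \<open>2 \<times> 2\<close> blocks
  centred at the lattice points \<open>w\<close> with \<open>\<bar>x\<bar> + \<bar>y\<bar> \<le> m\<close> and \<open>x + y + m\<close> even. Every domino in
  \<open>AD(m + 1)\<close> lies in exactly one of them, so a tiling amounts to a choice of pairwise disjoint
  sets \<open>t w\<close> of cells, one in each block, with union \<open>AD(m + 1)\<close>, together with a tiling of each
  \<open>t w\<close>. A cell of \<open>AD(m)\<close> lies in two blocks and any other cell of \<open>AD(m + 1)\<close> in one, so
  replacing each \<open>t w\<close> by its complement in the block exchanges the choices for \<open>AD(m + 1)\<close> and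
  \<open>AD(m)\<close>. The full block has two tilings while the empty set and the four halves have one, so
  the number of tilings of \<open>AD(m + 1)\<close> is \<open>2\<close> to the power (full blocks minus empty blocks) times
  that of \<open>AD(m)\<close>, and counting cells shows that this difference is always \<open>m + 1\<close>.
\<close>

section \<open>Domino tilings of sets of cells\<close>

type_synonym cell = "int \<times> int"

definition cell_dominoes :: "cell set set" where
  "cell_dominoes = {{(i, j), (i + 1, j)} | i j. True} \<union> {{(i, j), (i, j + 1)} | i j. True}"

definition tilings :: "cell set \<Rightarrow> cell set set set" where
  "tilings F = {M. M \<subseteq> cell_dominoes \<and> partition_on F M}"

definition num_tilings :: "cell set \<Rightarrow> nat" where
  "num_tilings F = card (tilings F)"

lemma empty_notin_cell_dominoes: "{} \<notin> cell_dominoes"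
  by (auto simp: cell_dominoes_def)

lemma tilings_iff:
  "M \<in> tilings F \<longleftrightarrow> M \<subseteq> cell_dominoes \<and> \<Union>M = F \<and> disjoint M"
  using empty_notin_cell_dominoes by (auto simp: tilings_def partition_on_def)

lemma finite_tilings: "finite F \<Longrightarrow> finite (tilings F)"
  by (rule finite_subset[OF _ finitely_many_partition_on]) (auto simp: tilings_def)

lemma num_tilings_empty [simp]: "num_tilings {} = 1"
proof -
  have "tilings {} = {{}}"
    by (auto simp: tilings_def partition_on_empty)
  then show ?thesis
    by (simp add: num_tilings_def)
qed

section \<open>Counting tilings through the domino at a chosen cell\<close>

lemma pair_in_cell_dominoes:
  "{(a, b), (c, d)} \<in> cell_dominoes \<longleftrightarrow>
     (b = d \<and> (c = a + 1 \<or> a = c + 1)) \<or> (a = c \<and> (d = b + 1 \<or> b = d + 1))"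
  by (auto simp: cell_dominoes_def doubleton_eq_iff)

lemma cell_dominoes_other:
  assumes "d \<in> cell_dominoes" "p \<in> d"
  obtains q where "d = {p, q}"
  using assms by (auto simp: cell_dominoes_def)

text \<open>The tilings are classified by the cell \<open>q\<close> that shares a domino with
  \<open>p\<close>. Deleting the domino \<open>{p, q}\<close> is a bijection from the tilings
  containing it to those of the remaining cells. All local counts below rest on this
  recursion.\<close>

lemma num_tilings_cover:
  assumes fin: "finite S" and p: "p \<in> S"
  shows "num_tilings S = (\<Sum>q\<in>{q \<in> S. {p, q} \<in> cell_dominoes}. num_tilings (S - {p, q}))"
proof -
  let ?Q = "{q \<in> S. {p, q} \<in> cell_dominoes}"
  let ?I = "\<lambda>q. insert {p, q} ` tilings (S - {p, q})"
  have notin: "{p, q} \<notin> M" if "M \<in> tilings (S - {p, q})" for M q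
    using that by (auto simp: tilings_iff)
  have "tilings S = (\<Union>q\<in>?Q. ?I q)"
  proof (intro subset_antisym subsetI)
    fix M assume M: "M \<in> tilings S"
    then obtain d where d: "d \<in> M" "p \<in> d"
      using p by (auto simp: tilings_iff)
    then obtain q where q: "d = {p, q}"
      using M cell_dominoes_other by (metis subsetD tilings_iff)
    have "M - {d} \<in> tilings (S - {p, q})"
    proof -
      have "\<Union>(M - {d}) = S - {p, q}"
      proof -
        have "\<Union>M = S" "\<And>e. e \<in> M \<Longrightarrow> e \<noteq> d \<Longrightarrow> e \<inter> d = {}"
          using M d(1) by (auto simp: tilings_iff disjoint_def)
        then show ?thesis
          unfolding q[symmetric] by blast
      qed
      moreover have "disjoint (M - {d})"
        using M by (auto simp: tilings_iff intro: pairwise_subset)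
      ultimately show ?thesis
        using M by (auto simp: tilings_iff)
    qed
    then have "M \<in> ?I q"
      using d q by (metis image_eqI insert_Diff)
    moreover have "q \<in> ?Q"
      using M d q by (auto simp: tilings_iff)
    ultimately show "M \<in> (\<Union>q\<in>?Q. ?I q)"
      by blast
  next
    fix M assume "M \<in> (\<Union>q\<in>?Q. ?I q)"
    then obtain q N where q: "q \<in> S" "{p, q} \<in> cell_dominoes" and M: "M = insert {p, q} N"
      and N: "N \<subseteq> cell_dominoes" "\<Union>N = S - {p, q}" "disjoint N"
      by (auto simp: tilings_iff)
    have "disjoint M"
      unfolding M pairwise_insert using N by (auto simp: disjnt_def)
    moreover have "\<Union>M = S"
      using M N q p by auto
    ultimately show "M \<in> tilings S"
      using M N q by (simp add: tilings_iff)
  qed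
  moreover have "card (\<Union>q\<in>?Q. ?I q) = (\<Sum>q\<in>?Q. card (?I q))"
  proof (rule card_UN_disjoint)
    show "\<forall>i\<in>?Q. \<forall>j\<in>?Q. i \<noteq> j \<longrightarrow> ?I i \<inter> ?I j = {}"
    proof (intro ballI impI equals0I)
      fix i j M assume "i \<noteq> j" "M \<in> ?I i \<inter> ?I j"
      then obtain A B where AB: "M = insert {p, i} A" "A \<in> tilings (S - {p, i})"
        "M = insert {p, j} B" by blast
      have "{p, j} \<noteq> {p, i}"
        using \<open>i \<noteq> j\<close> by (auto simp: doubleton_eq_iff)
      then have "{p, j} \<in> A"
        using AB(1,3) by (metis insertE insertI1)
      then have "p \<in> \<Union>A"
        by blast
      then show False
        using AB(2) by (metis Diff_iff insertI1 tilings_iff)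
    qed
    show "finite ?Q"
      using fin by simp
    show "\<forall>q\<in>?Q. finite (?I q)"
      using fin by (intro ballI finite_imageI finite_tilings) simp
  qed
  moreover have "card (?I q) = num_tilings (S - {p, q})" for q
    unfolding num_tilings_def
  proof (rule card_image, rule inj_onI)
    fix M N assume "M \<in> tilings (S - {p, q})" "N \<in> tilings (S - {p, q})"
      and "insert {p, q} M = insert {p, q} N"
    then show "M = N"
      using notin[of M q] notin[of N q] by (simp add: insert_ident)
  qed
  ultimately show ?thesis
    by (simp add: num_tilings_def)
qed

lemma num_tilings_isolated:
  assumes "finite S" "p \<in> S" "\<And>q. q \<in> S \<Longrightarrow> {p, q} \<notin> cell_dominoes"
  shows "num_tilings S = 0"
proof -
  have "{q \<in> S. {p, q} \<in> cell_dominoes} = {}"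
    using assms(3) by blast
  then show ?thesis
    using num_tilings_cover[OF assms(1,2)] by (simp only: sum.empty)
qed

lemma num_tilings_forced:
  assumes "finite S" "p \<in> S" "q \<in> S" "\<And>q'. q' \<in> S \<Longrightarrow> {p, q'} \<in> cell_dominoes \<longleftrightarrow> q' = q"
  shows "num_tilings S = num_tilings (S - {p, q})"
proof -
  have "{q \<in> S. {p, q} \<in> cell_dominoes} = {q}"
    using assms(3,4) by blast
  then show ?thesis
    using num_tilings_cover[OF assms(1,2)] by simp
qed

lemma num_tilings_two_ways:
  assumes "finite S" "p \<in> S" "q \<in> S" "r \<in> S" "q \<noteq> r"
    "\<And>q'. q' \<in> S \<Longrightarrow> {p, q'} \<in> cell_dominoes \<longleftrightarrow> q' = q \<or> q' = r"
  shows "num_tilings S = num_tilings (S - {p, q}) + num_tilings (S - {p, r})"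
proof -
  have "{q \<in> S. {p, q} \<in> cell_dominoes} = {q, r}"
    using assms(3,4,6) by blast
  then show ?thesis
    using num_tilings_cover[OF assms(1,2)] assms(5) by simp
qed

text \<open>A tiling splits into the set \<open>X\<close> of its dominoes in \<open>P\<close>, those
  inside \<open>A\<close> and those inside \<open>B\<close>. The three families can be recovered
  from the tiling, because a domino in \<open>P\<close> meets both parts and so lies in neither. The
  application takes for \<open>P\<close> the vertical dominoes across the cut.\<close>

lemma num_tilings_bridges:
  assumes fin: "finite A" "finite B" and AB: "A \<inter> B = {}"
    and P: "P \<subseteq> cell_dominoes" "disjoint P"
    and meet: "\<And>d. d \<in> P \<Longrightarrow> d \<inter> A \<noteq> {} \<and> d \<inter> B \<noteq> {} \<and> d \<subseteq> A \<union> B"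
    and cases: "\<And>d. d \<in> cell_dominoes \<Longrightarrow> d \<subseteq> A \<union> B \<Longrightarrow> d \<subseteq> A \<or> d \<subseteq> B \<or> d \<in> P"
  shows "num_tilings (A \<union> B) = (\<Sum>X\<in>Pow P. num_tilings (A - \<Union>X) * num_tilings (B - \<Union>X))"
proof -
  let ?S = "Sigma (Pow P) (\<lambda>X. tilings (A - \<Union>X) \<times> tilings (B - \<Union>X))"
  let ?f = "\<lambda>(X, MA, MB). X \<union> MA \<union> MB"
  let ?g = "\<lambda>M. (M \<inter> P, {d \<in> M. d \<subseteq> A}, {d \<in> M. d \<subseteq> B})"
  have "P \<subseteq> Pow (A \<union> B)"
    using meet by blast
  then have "finite P"
    using fin by (meson finite_Pow_iff finite_UnI finite_subset)
  have ne: "d \<noteq> {}" if "d \<in> cell_dominoes" for d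
    using that empty_notin_cell_dominoes by blast
  have "bij_betw ?f ?S (tilings (A \<union> B))"
  proof (rule bij_betw_byWitness[where f' = ?g])
    show "\<forall>a\<in>?S. ?g (?f a) = a"
    proof
      fix a assume "a \<in> ?S"
      then obtain X MA MB where a_eq: "a = (X, MA, MB)"
        and X: "X \<subseteq> P" and MA: "MA \<in> tilings (A - \<Union>X)" and MB: "MB \<in> tilings (B - \<Union>X)"
        by auto
      have a: "d \<subseteq> A \<and> d \<noteq> {}" if "d \<in> MA" for d
        using that MA ne by (auto simp: tilings_iff)
      have b: "d \<subseteq> B \<and> d \<noteq> {}" if "d \<in> MB" for d
        using that MB ne by (auto simp: tilings_iff)
      have x: "\<not> d \<subseteq> A \<and> \<not> d \<subseteq> B" if "d \<in> P" for d
        using meet[OF that] AB by blast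
      have ab: "\<not> (d \<subseteq> A \<and> d \<subseteq> B)" if "d \<in> MA \<or> d \<in> MB" for d
        using a b that AB by blast
      show "?g (?f a) = a"
      proof -
        have "(X \<union> MA \<union> MB) \<inter> P = X"
          using X a b x by blast
        moreover have "{d \<in> X \<union> MA \<union> MB. d \<subseteq> A} = MA"
          using X a x ab b by blast
        moreover have "{d \<in> X \<union> MA \<union> MB. d \<subseteq> B} = MB"
          using X a x ab b by blast
        ultimately show ?thesis
          by (simp add: a_eq)
      qed
    qed
    show "\<forall>M\<in>tilings (A \<union> B). ?f (?g M) = M"
    proof
      fix M assume M: "M \<in> tilings (A \<union> B)"
      have "d \<subseteq> A \<or> d \<subseteq> B \<or> d \<in> P" if "d \<in> M" for d
        using M that cases[of d] by (auto simp: tilings_iff)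
      then show "?f (?g M) = M"
        by auto
    qed
    show "?f ` ?S \<subseteq> tilings (A \<union> B)"
    proof clarify
      fix X MA MB
      assume X: "X \<subseteq> P" and MA: "MA \<in> tilings (A - \<Union>X)" and MB: "MB \<in> tilings (B - \<Union>X)"
      have U: "\<Union>MA = A - \<Union>X" "\<Union>MB = B - \<Union>X" "\<Union>X \<subseteq> A \<union> B"
        using MA MB X meet by (auto simp: tilings_iff)
      then have "\<Union>(X \<union> MA \<union> MB) = A \<union> B"
        by auto
      moreover have "disjoint (X \<union> MA \<union> MB)"
      proof (rule pairwiseI)
        fix d e assume de: "d \<in> X \<union> MA \<union> MB" "e \<in> X \<union> MA \<union> MB" "d \<noteq> e"
        have "disjoint X" "disjoint MA" "disjoint MB"
          using X P MA MB by (auto simp: tilings_iff intro: pairwise_subset)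
        then have same: "disjnt d e" if "d \<in> X \<and> e \<in> X \<or> d \<in> MA \<and> e \<in> MA \<or> d \<in> MB \<and> e \<in> MB"
          using that de(3) by (auto simp: pairwise_def)
        have "\<Union>X \<inter> \<Union>MA = {}" "\<Union>X \<inter> \<Union>MB = {}" "\<Union>MA \<inter> \<Union>MB = {}"
          using U AB by auto
        then show "disjnt d e"
          using de same unfolding disjnt_def by blast
      qed
      ultimately show "X \<union> MA \<union> MB \<in> tilings (A \<union> B)"
        using X MA MB P by (auto simp: tilings_iff)
    qed
    show "?g ` tilings (A \<union> B) \<subseteq> ?S"
    proof (rule image_subsetI)
      fix M assume M: "M \<in> tilings (A \<union> B)"
      have c: "d \<subseteq> A \<or> d \<subseteq> B \<or> d \<in> P" if "d \<in> M" for d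
        using M that cases[of d] by (auto simp: tilings_iff)
      have dj: "d = e" if "d \<in> M" "e \<in> M" "z \<in> d" "z \<in> e" for d e z
        using M that unfolding tilings_iff disjoint_def by blast
      have U: "\<exists>d\<in>M. z \<in> d" if "z \<in> A \<or> z \<in> B" for z
        using M that by (auto simp: tilings_iff)
      have "\<Union>{d \<in> M. d \<subseteq> A} = A - \<Union>(M \<inter> P)"
      proof (intro subset_antisym subsetI)
        fix z assume "z \<in> \<Union>{d \<in> M. d \<subseteq> A}"
        then obtain d where d: "d \<in> M" "d \<subseteq> A" "z \<in> d" by blast
        have "d \<notin> P" using meet[of d] d AB by blast
        then show "z \<in> A - \<Union>(M \<inter> P)" using d dj by blast
      next
        fix z assume z: "z \<in> A - \<Union>(M \<inter> P)"
        then obtain d where d: "d \<in> M" "z \<in> d" using U by blast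
        then show "z \<in> \<Union>{d \<in> M. d \<subseteq> A}" using c[OF d(1)] z AB by blast
      qed
      moreover have "\<Union>{d \<in> M. d \<subseteq> B} = B - \<Union>(M \<inter> P)"
      proof (intro subset_antisym subsetI)
        fix z assume "z \<in> \<Union>{d \<in> M. d \<subseteq> B}"
        then obtain d where d: "d \<in> M" "d \<subseteq> B" "z \<in> d" by blast
        have "d \<notin> P" using meet[of d] d AB by blast
        then show "z \<in> B - \<Union>(M \<inter> P)" using d dj by blast
      next
        fix z assume z: "z \<in> B - \<Union>(M \<inter> P)"
        then obtain d where d: "d \<in> M" "z \<in> d" using U by blast
        then show "z \<in> \<Union>{d \<in> M. d \<subseteq> B}" using c[OF d(1)] z AB by blast
      qed
      ultimately show "?g M \<in> ?S"
        using M by (auto simp: tilings_iff pairwise_def)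
    qed
  qed
  then have "card (tilings (A \<union> B)) = card ?S"
    by (simp add: bij_betw_same_card)
  also have "\<dots> = (\<Sum>X\<in>Pow P. card (tilings (A - \<Union>X) \<times> tilings (B - \<Union>X)))"
    using \<open>finite P\<close> fin by (intro card_SigmaI) (auto intro: finite_tilings)
  finally show ?thesis
    by (simp only: num_tilings_def card_cartesian_product)
qed

text \<open>Grouping the dominoes of a tiling by the unique block containing them gives, for each
  \<open>w\<close>, a region \<open>t w\<close> together with a tiling of it. Extensional function
  spaces make this data unique, so the grouping is a bijection.\<close>

lemma num_tilings_blocks:
  assumes fin: "finite V" "finite F" and finb: "\<And>w. w \<in> V \<Longrightarrow> finite (b w)"
    and unique: "\<And>d. d \<in> cell_dominoes \<Longrightarrow> d \<subseteq> F \<Longrightarrow> \<exists>!w. w \<in> V \<and> d \<subseteq> b w"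
  shows "num_tilings F =
    (\<Sum>t | t \<in> (\<Pi>\<^sub>E w\<in>V. Pow (b w)) \<and> disjoint_family_on t V \<and> (\<Union>w\<in>V. t w) = F.
      \<Prod>w\<in>V. num_tilings (t w))"
proof -
  let ?T = "{t. t \<in> (\<Pi>\<^sub>E w\<in>V. Pow (b w)) \<and> disjoint_family_on t V \<and> (\<Union>w\<in>V. t w) = F}"
  let ?S = "Sigma ?T (\<lambda>t. \<Pi>\<^sub>E w\<in>V. tilings (t w))"
  let ?f = "\<lambda>(t, g). \<Union>w\<in>V. g w"
  let ?m = "\<lambda>M w. {d \<in> M. d \<subseteq> b w}"
  let ?g = "\<lambda>M. (restrict (\<lambda>w. \<Union>(?m M w)) V, restrict (?m M) V)"
  have "finite (\<Pi>\<^sub>E w\<in>V. Pow (b w))"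
    using fin finb by (intro finite_PiE) auto
  then have finT: "finite ?T"
    by (rule finite_subset[rotated]) auto
  have un: "w = w'" if "d \<in> cell_dominoes" "d \<subseteq> F" "w \<in> V" "d \<subseteq> b w" "w' \<in> V" "d \<subseteq> b w'"
    for d w w'
    using unique[OF that(1,2)] that by blast
  have "bij_betw ?f ?S (tilings F)"
  proof (rule bij_betw_byWitness[where f' = ?g])
    show "\<forall>a\<in>?S. ?g (?f a) = a"
    proof
      fix a assume "a \<in> ?S"
      then obtain t g where a_eq: "a = (t, g)" and t: "t \<in> (\<Pi>\<^sub>E w\<in>V. Pow (b w))"
        and F: "F = (\<Union>w\<in>V. t w)" and g: "g \<in> (\<Pi>\<^sub>E w\<in>V. tilings (t w))"
        by blast
      have gw: "d \<in> cell_dominoes \<and> d \<subseteq> t w \<and> d \<subseteq> b w \<and> d \<subseteq> F" if "w \<in> V" "d \<in> g w" for w d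
      proof -
        have "g w \<in> tilings (t w)" "t w \<subseteq> b w" using g t that by auto
        then show ?thesis using that F by (auto simp: tilings_iff)
      qed
      have m: "?m (\<Union>w\<in>V. g w) w = g w" if "w \<in> V" for w
      proof (intro subset_antisym subsetI)
        fix d assume "d \<in> ?m (\<Union>w\<in>V. g w) w"
        then obtain v where v: "v \<in> V" "d \<in> g v" "d \<subseteq> b w" by blast
        then have "v = w" using un[of d v w] gw[OF v(1,2)] that by blast
        then show "d \<in> g w" using v by simp
      qed (use gw that in blast)
      have "\<Union>(g w) = t w" if "w \<in> V" for w
        using g that by (auto simp: tilings_iff PiE_iff)
      then have "restrict (\<lambda>w. \<Union>(?m (\<Union>w\<in>V. g w) w)) V = t"
        using t m by (intro extensionalityI[where A = V]) (simp_all add: PiE_iff)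
      moreover have "restrict (?m (\<Union>w\<in>V. g w)) V = g"
        using g m by (intro extensionalityI[where A = V]) (simp_all add: PiE_iff)
      ultimately show "?g (?f a) = a"
        by (simp add: a_eq)
    qed
    show "\<forall>M\<in>tilings F. ?f (?g M) = M"
    proof
      fix M assume M: "M \<in> tilings F"
      have "\<exists>w\<in>V. d \<subseteq> b w" if "d \<in> M" for d
        using M that unique[of d] by (auto simp: tilings_iff)
      then show "?f (?g M) = M"
        by auto
    qed
    show "?f ` ?S \<subseteq> tilings F"
    proof clarify
      fix t g
      assume t: "disjoint_family_on t V" and F: "F = (\<Union>w\<in>V. t w)"
        and g: "g \<in> (\<Pi>\<^sub>E w\<in>V. tilings (t w))"
      have gw: "g w \<subseteq> cell_dominoes \<and> \<Union>(g w) = t w \<and> disjoint (g w)" if "w \<in> V" for w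
        using g that by (auto simp: tilings_iff PiE_iff)
      have "disjoint (\<Union>w\<in>V. g w)"
      proof (rule pairwiseI)
        fix d e assume "d \<in> (\<Union>w\<in>V. g w)" "e \<in> (\<Union>w\<in>V. g w)" "d \<noteq> e"
        then obtain v w where vw: "v \<in> V" "w \<in> V" "d \<in> g v" "e \<in> g w" by blast
        show "disjnt d e"
        proof (cases "v = w")
          case True
          then show ?thesis using gw vw \<open>d \<noteq> e\<close> by (auto simp: pairwise_def)
        next
          case False
          then have "t v \<inter> t w = {}" using t vw by (auto simp: disjoint_family_on_def)
          then show ?thesis using gw vw by (auto simp: disjnt_def)
        qed
      qed
      moreover have "\<Union>(\<Union>w\<in>V. g w) = (\<Union>w\<in>V. t w)"
      proof -
        have "\<Union>(\<Union>w\<in>V. g w) = (\<Union>w\<in>V. \<Union>(g w))"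
          by blast
        then show ?thesis
          using gw by simp
      qed
      moreover have "(\<Union>w\<in>V. g w) \<subseteq> cell_dominoes"
        using gw by blast
      ultimately show "(\<Union>w\<in>V. g w) \<in> tilings (\<Union>w\<in>V. t w)"
        by (simp only: tilings_iff)
    qed
    show "?g ` tilings F \<subseteq> ?S"
    proof (rule image_subsetI)
      fix M assume M: "M \<in> tilings F"
      have ex: "\<exists>w\<in>V. d \<subseteq> b w" if "d \<in> M" for d
        using M that unique[of d] by (auto simp: tilings_iff)
      have "disjoint_family_on (\<lambda>w. \<Union>(?m M w)) V"
      proof (unfold disjoint_family_on_def, intro ballI impI equals0I)
        fix v w z
        assume vw: "v \<in> V" "w \<in> V" "v \<noteq> w" and "z \<in> \<Union>(?m M v) \<inter> \<Union>(?m M w)"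
        then obtain d e where de: "d \<in> M" "e \<in> M" "d \<subseteq> b v" "e \<subseteq> b w" "z \<in> d" "z \<in> e"
          by blast
        then have "d = e" using M unfolding tilings_iff disjoint_def by blast
        moreover have "d \<in> cell_dominoes" "d \<subseteq> F" using M de by (auto simp: tilings_iff)
        ultimately show False using un vw de by blast
      qed
      moreover have "(\<Union>w\<in>V. \<Union>(?m M w)) = F"
      proof -
        have "(\<Union>w\<in>V. \<Union>(?m M w)) = \<Union>M"
          using ex by blast
        then show ?thesis
          using M by (simp add: tilings_iff)
      qed
      moreover have "?m M w \<in> tilings (\<Union>(?m M w))" for w
        using M by (auto simp: tilings_iff pairwise_def)
      ultimately show "?g M \<in> ?S"
        by (auto simp: disjoint_family_on_def)
    qed
  qed
  then have "num_tilings F = card ?S"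
    by (simp add: bij_betw_same_card num_tilings_def)
  also have "\<dots> = (\<Sum>t\<in>?T. card (\<Pi>\<^sub>E w\<in>V. tilings (t w)))"
  proof (rule card_SigmaI[OF finT], intro ballI finite_PiE fin(1) finite_tilings)
    fix t w assume "t \<in> ?T" "w \<in> V"
    then have "t w \<subseteq> b w" by auto
    then show "finite (t w)" using finb \<open>w \<in> V\<close> finite_subset by blast
  qed
  finally show ?thesis
    by (simp add: card_PiE fin num_tilings_def)
qed


section \<open>Geometric tilings\<close>

text \<open>
  The cell \<open>(i, j)\<close> stands for \<open>unit_square i j\<close>; the farthest corner of that square from the origin
  has \<open>\<bar>x\<bar> + \<bar>y\<bar> = (\<bar>2 * i + 1\<bar> + \<bar>2 * j + 1\<bar>) / 2 + 1\<close>.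
\<close>

definition aztec_cells :: "nat \<Rightarrow> cell set" where
  "aztec_cells n = {(i, j). \<bar>2 * i + 1\<bar> + \<bar>2 * j + 1\<bar> \<le> 2 * int n}"

definition squares_union :: "cell set \<Rightarrow> (real \<times> real) set" where
  "squares_union A = (\<Union>(i, j)\<in>A. unit_square i j)"

lemma unit_square_subset_iff:
  "unit_square i j \<subseteq> {(x, y). \<bar>x\<bar> + \<bar>y\<bar> \<le> real n + 1} \<longleftrightarrow> (i, j) \<in> aztec_cells n"
proof
  assume sub: "unit_square i j \<subseteq> {(x, y). \<bar>x\<bar> + \<bar>y\<bar> \<le> real n + 1}"
  have "(of_int a, of_int b) \<in> unit_square i j" if "a \<in> {i, i + 1}" "b \<in> {j, j + 1}" for a b
    using that by (auto simp: unit_square_def)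
  then have *: "\<bar>real_of_int a\<bar> + \<bar>real_of_int b\<bar> \<le> real n + 1" if "a \<in> {i, i + 1}" "b \<in> {j, j + 1}" for a b
    using that sub by blast
  then have le: "\<bar>a\<bar> + \<bar>b\<bar> \<le> int n + 1" if "a \<in> {i, i + 1}" "b \<in> {j, j + 1}" for a b
  proof -
    have "real_of_int (\<bar>a\<bar> + \<bar>b\<bar>) \<le> real_of_int (int n + 1)"
      using * that by simp
    then show ?thesis
      by (simp only: of_int_le_iff)
  qed
  \<comment> \<open>Of the two ends of \<open>[k, k + 1]\<close>, the one farther from 0 is chosen;
    in both coordinates together this selects the farthest corner of the square.\<close>
  have far: "\<exists>a\<in>{k, k + 1}. \<bar>2 * k + 1\<bar> = 2 * \<bar>a\<bar> - 1" for k :: int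
    by (cases "k \<ge> 0") auto
  obtain a b where "a \<in> {i, i + 1}" "\<bar>2 * i + 1\<bar> = 2 * \<bar>a\<bar> - 1"
    "b \<in> {j, j + 1}" "\<bar>2 * j + 1\<bar> = 2 * \<bar>b\<bar> - 1"
    using far[of i] far[of j] by blast
  then show "(i, j) \<in> aztec_cells n"
    using le[of a b] by (simp add: aztec_cells_def)
next
  assume "(i, j) \<in> aztec_cells n"
  then have "\<bar>2 * i + 1\<bar> + \<bar>2 * j + 1\<bar> \<le> 2 * int n"
    by (simp add: aztec_cells_def)
  then have le: "\<bar>2 * real_of_int i + 1\<bar> + \<bar>2 * real_of_int j + 1\<bar> \<le> 2 * real n"
    by linarith
  show "unit_square i j \<subseteq> {(x, y). \<bar>x\<bar> + \<bar>y\<bar> \<le> real n + 1}"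
  proof clarsimp
    fix x y assume "(x, y) \<in> unit_square i j"
    then have "real_of_int i \<le> x" "x \<le> real_of_int i + 1" "real_of_int j \<le> y" "y \<le> real_of_int j + 1"
      by (auto simp: unit_square_def)
    with le show "\<bar>x\<bar> + \<bar>y\<bar> \<le> real n + 1"
      by linarith
  qed
qed

lemma aztec_diamond_eq: "aztec_diamond n = squares_union (aztec_cells n)"
  unfolding aztec_diamond_def unit_square_subset_iff squares_union_def by auto

text \<open>Closed unit squares share boundary points, but the centre of a square lies in no other
  one. Testing membership at centres recovers the cells from the region.\<close>

lemma center_in_squares_union:
  "(of_int i + 1/2, of_int j + 1/2) \<in> squares_union A \<longleftrightarrow> (i, j) \<in> A"
proof -
  have "(of_int i + 1/2, of_int j + 1/2) \<in> unit_square i' j' \<longleftrightarrow> i' = i \<and> j' = j" for i' j'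
  proof -
    have "real_of_int k \<le> of_int m + 1/2 \<and> of_int m + 1/2 \<le> real_of_int k + 1 \<longleftrightarrow> k = m" for k m
      by linarith
    then show ?thesis
      by (auto simp: unit_square_def)
  qed
  then show ?thesis
    by (auto simp: squares_union_def)
qed

lemma inj_squares_union: "inj squares_union"
proof (rule injI)
  fix A B assume "squares_union A = squares_union B"
  then have "(i, j) \<in> A \<longleftrightarrow> (i, j) \<in> B" for i j
    using center_in_squares_union[of i j A] center_in_squares_union[of i j B] by simp
  then show "A = B" by auto
qed

lemma squares_union_Union: "squares_union (\<Union>M) = \<Union>(squares_union ` M)"
  by (auto simp: squares_union_def)

lemma dominoes_eq: "dominoes = squares_union ` cell_dominoes"
proof -
  have "squares_union {p, q} = unit_square (fst p) (snd p) \<union> unit_square (fst q) (snd q)" for p q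
    by (auto simp: squares_union_def)
  then have "unit_square i j \<union> unit_square (i + 1) j = squares_union {(i, j), (i + 1, j)}"
      "unit_square i j \<union> unit_square i (j + 1) = squares_union {(i, j), (i, j + 1)}" for i j
    by simp_all
  moreover have "squares_union ` {g i j | i j. True} = {squares_union (g i j) | i j. True}"
    for g :: "int \<Rightarrow> int \<Rightarrow> cell set"
    by blast
  ultimately show ?thesis
    by (simp only: dominoes_def cell_dominoes_def image_Un)
qed

text \<open>Both orientations are put into one form: a half-open integer rectangle for the cells and
  a closed box for the region, the latter as required by \<open>division_of\<close>.\<close>

lemma cell_domino_rectangle:
  assumes "d \<in> cell_dominoes"
  obtains i j p q where "p > 0" "q > 0" "d = {i..<i + p} \<times> {j..<j + q}"
    "squares_union d = cbox (of_int i, of_int j) (of_int (i + p), of_int (j + q))"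
proof -
  have c: "cbox (a, b) (c, d) = {a..c} \<times> {b..d}" for a b c d :: real
    by (auto simp: cbox_Pair_eq)
  have s: "squares_union {r, s} = unit_square (fst r) (snd r) \<union> unit_square (fst s) (snd s)" for r s
    by (auto simp: squares_union_def)
  have two: "{k..<k + 2} = {k, k + 1}" and one: "{k..<k + 1} = {k}" for k :: int
    by auto
  from assms consider i j where "d = {(i, j), (i + 1, j)}" | i j where "d = {(i, j), (i, j + 1)}"
    by (auto simp: cell_dominoes_def)
  then show ?thesis
  proof cases
    case 1
    show ?thesis
      by (rule that[of 2 1 i j]) (auto simp: 1 c s two one unit_square_def)
  next
    case 2
    show ?thesis
      by (rule that[of 1 2 i j]) (auto simp: 2 c s two one unit_square_def)
  qed
qed

text \<open>Both interiors are products of open intervals with integer ends. Intersections of such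
  intervals are again of this kind, and they are empty exactly when the corresponding half-open
  integer intervals have empty intersection.\<close>

lemma interior_disjoint_iff:
  assumes "d \<in> cell_dominoes" "e \<in> cell_dominoes"
  shows "interior (squares_union d) \<inter> interior (squares_union e) = {} \<longleftrightarrow> d \<inter> e = {}"
proof -
  obtain i j p q where d: "p > 0" "q > 0" "d = {i..<i + p} \<times> {j..<j + q}"
    "squares_union d = cbox (of_int i, of_int j) (of_int (i + p), of_int (j + q))"
    using assms(1) by (rule cell_domino_rectangle)
  obtain i' j' p' q' where e: "p' > 0" "q' > 0" "e = {i'..<i' + p'} \<times> {j'..<j' + q'}"
    "squares_union e = cbox (of_int i', of_int j') (of_int (i' + p'), of_int (j' + q'))"
    using assms(2) by (rule cell_domino_rectangle)
  have b: "box (a, b) (c, d) = {a<..<c} \<times> {b<..<d}" for a b c d :: real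
    by (auto simp: box_def Basis_prod_def)
  have R: "{real_of_int a<..<of_int (a + u)} \<inter> {real_of_int a'<..<of_int (a' + u')} = {} \<longleftrightarrow>
      {a..<a + u} \<inter> {a'..<a' + u'} = {}" if "u > 0" "u' > 0" for a u a' u'
  proof -
    have "{real_of_int a<..<of_int (a + u)} \<inter> {real_of_int a'<..<of_int (a' + u')} =
        {real_of_int (max a a')<..<real_of_int (min (a + u) (a' + u'))}"
      by (auto simp: max_def min_def)
    moreover have "{a..<a + u} \<inter> {a'..<a' + u'} = {max a a'..<min (a + u) (a' + u')}"
      by auto
    ultimately show ?thesis
      by (simp only: greaterThanLessThan_empty_iff atLeastLessThan_empty_iff of_int_le_iff not_less)
  qed
  show ?thesis
    unfolding d(4) e(4) unfolding d(3) e(3) interior_cbox b Times_Int_Times Times_empty R[OF d(1) e(1)] R[OF d(2) e(2)] ..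
qed

text \<open>Injectivity of \<open>squares_union\<close> translates equality of regions into equality
  of cell sets, and \<open>interior_disjoint_iff\<close> translates the condition on interiors.
  Finiteness of \<open>F\<close> makes \<open>M\<close> finite, as a division must be.\<close>

lemma squares_union_division_iff:
  assumes M: "M \<subseteq> cell_dominoes" and "finite F"
  shows "squares_union ` M division_of squares_union F \<longleftrightarrow> M \<in> tilings F"
proof
  assume div: "squares_union ` M division_of squares_union F"
  have "squares_union (\<Union>M) = squares_union F"
    using division_ofD(6)[OF div] by (simp add: squares_union_Union)
  then have "\<Union>M = F"
    using inj_squares_union by (simp add: inj_eq)
  moreover have "disjoint M"
  proof (rule pairwiseI)
    fix d e assume de: "d \<in> M" "e \<in> M" "d \<noteq> e"
    then have "squares_union d \<noteq> squares_union e"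
      using inj_squares_union by (simp add: inj_eq)
    then have "interior (squares_union d) \<inter> interior (squares_union e) = {}"
      using division_ofD(5)[OF div] de by blast
    then show "disjnt d e"
      using interior_disjoint_iff[of d e] M de unfolding disjnt_def by blast
  qed
  ultimately show "M \<in> tilings F"
    using M by (simp add: tilings_iff)
next
  assume T: "M \<in> tilings F"
  then have U: "\<Union>M = F" and dis: "disjoint M"
    by (auto simp: tilings_iff)
  show "squares_union ` M division_of squares_union F"
  proof (rule division_ofI)
    show "finite (squares_union ` M)"
      using U \<open>finite F\<close> finite_UnionD by blast
    show U': "\<Union>(squares_union ` M) = squares_union F"
      using U squares_union_Union by metis
    fix K assume "K \<in> squares_union ` M"
    then obtain d where d: "d \<in> M" "K = squares_union d" by blast
    show "K \<subseteq> squares_union F"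
      using U' d by blast
    have "d \<in> cell_dominoes"
      using d M by blast
    then obtain i j p q where r: "p > 0" "q > 0" "d = {i..<i + p} \<times> {j..<j + q}"
      "squares_union d = cbox (of_int i, of_int j) (of_int (i + p), of_int (j + q))"
      by (rule cell_domino_rectangle)
    then show "\<exists>a b. K = cbox a b"
      using d by blast
    show "K \<noteq> {}"
      using r d by (auto simp: cbox_Pair_eq)
  next
    fix K L assume "K \<in> squares_union ` M" "L \<in> squares_union ` M" and "K \<noteq> L"
    then obtain d e where de: "d \<in> M" "e \<in> M" "K = squares_union d" "L = squares_union e" "d \<noteq> e"
      by blast
    then have "d \<inter> e = {}"
      using dis unfolding disjoint_def by blast
    then show "interior K \<inter> interior L = {}"
      using M de interior_disjoint_iff[of d e] by blast
  qed
qed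

lemma card_domino_tilings:
  assumes "finite F"
  shows "card (domino_tilings (squares_union F)) = num_tilings F"
proof -
  have "domino_tilings (squares_union F) = (\<lambda>M. squares_union ` M) ` tilings F"
  proof (intro subset_antisym subsetI)
    fix T assume "T \<in> domino_tilings (squares_union F)"
    then have T: "T \<subseteq> squares_union ` cell_dominoes" "T division_of squares_union F"
      by (auto simp: domino_tilings_def dominoes_eq)
    then obtain M where M: "M \<subseteq> cell_dominoes" "T = squares_union ` M"
      by (meson subset_imageE)
    then show "T \<in> (\<lambda>M. squares_union ` M) ` tilings F"
      using T squares_union_division_iff[OF M(1) assms] by blast
  next
    fix T assume "T \<in> (\<lambda>M. squares_union ` M) ` tilings F"
    then obtain M where M: "M \<in> tilings F" "T = squares_union ` M" by blast
    then have "M \<subseteq> cell_dominoes"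
      by (simp add: tilings_iff)
    then show "T \<in> domino_tilings (squares_union F)"
      using M squares_union_division_iff[OF _ assms] by (auto simp: domino_tilings_def dominoes_eq)
  qed
  moreover have "inj_on (\<lambda>M. squares_union ` M) (tilings F)"
    using inj_squares_union by (simp add: inj_on_def inj_image_eq_iff)
  ultimately show ?thesis
    by (simp add: card_image num_tilings_def)
qed

lemma finite_aztec_cells: "finite (aztec_cells n)"
proof (rule finite_subset)
  show "aztec_cells n \<subseteq> {- int n..int n} \<times> {- int n..int n}"
    by (auto simp: aztec_cells_def)
qed simp


section \<open>The Aztec diamond theorem\<close>

definition block :: "int \<times> int \<Rightarrow> cell set" where
  "block w = (case w of (x, y) \<Rightarrow> {(x - 1, y - 1), (x - 1, y), (x, y - 1), (x, y)})"

definition centers :: "nat \<Rightarrow> (int \<times> int) set" where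
  "centers m = {(x, y). \<bar>x\<bar> + \<bar>y\<bar> \<le> int m \<and> even (x + y + int m)}"

text \<open>If \<open>\<bar>x\<bar> + \<bar>y\<bar>\<close> equals \<open>m + 1\<close>, then
  \<open>x + y + m\<close> is odd. Hence the bound in \<open>centers\<close> may be relaxed by one,
  to what the corners of cells satisfy directly.\<close>

lemma in_centers_iff_even:
  assumes "\<bar>x\<bar> + \<bar>y\<bar> \<le> int m + 1"
  shows "(x, y) \<in> centers m \<longleftrightarrow> even (x + y + int m)"
proof -
  have "even (x + y + int m) \<longleftrightarrow> even (\<bar>x\<bar> + \<bar>y\<bar> + int m)"
    by simp
  moreover have "\<not> even (int m + 1 + int m)"
    by simp
  ultimately have "even (x + y + int m) \<longrightarrow> \<bar>x\<bar> + \<bar>y\<bar> \<noteq> int m + 1"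
    by metis
  then have "even (x + y + int m) \<longrightarrow> \<bar>x\<bar> + \<bar>y\<bar> \<le> int m"
    using assms by linarith
  then show ?thesis
    unfolding centers_def mem_Collect_eq prod.case by blast
qed

lemma finite_block: "finite (block w)"
  by (simp add: block_def split: prod.split)

lemma finite_centers: "finite (centers m)"
  by (rule finite_subset[of _ "{- int m..int m} \<times> {- int m..int m}"]) (auto simp: centers_def)

text \<open>This form of \<open>num_tilings_cover\<close> lets the simplifier evaluate the count for
  explicitly listed cells.\<close>

lemma num_tilings_insert:
  assumes "finite S" "p \<notin> S"
  shows "num_tilings (insert p S) = (\<Sum>q\<in>S. if {p, q} \<in> cell_dominoes then num_tilings (S - {q}) else 0)"
proof -
  have "{p} \<notin> cell_dominoes"
    by (auto simp: cell_dominoes_def doubleton_eq_iff)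
  then have "{q \<in> insert p S. {p, q} \<in> cell_dominoes} = {q \<in> S. {p, q} \<in> cell_dominoes}"
    by auto
  moreover have "insert p S - {p, q} = S - {q}" for q
    using assms by auto
  ultimately show ?thesis
    using num_tilings_cover[of "insert p S" p] assms by (simp add: sum.If_cases Int_def)
qed

text \<open>
  The number of tilings is multiplied by \<open>2\<close> to the power \<open>(card (block w - c) - card c) / 4\<close> when
  \<open>c\<close> is replaced by its complement; the fourth powers avoid the division.
\<close>

lemma num_tilings_block_complement:
  assumes "c \<subseteq> block w"
  shows "num_tilings (block w - c) ^ 4 * 2 ^ card c = num_tilings c ^ 4 * 2 ^ card (block w - c)"
proof -
  obtain x y where w: "w = (x, y)" by (cases w)
  \<comment> \<open>The sixteen subsets are checked one by one. The four halves are exchanged among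
    themselves with one tiling each, the empty set and the full block have one and two, and all
    others, like their complements, have none.\<close>
  have "c \<in> Pow {(x - 1, y - 1), (x - 1, y), (x, y - 1), (x, y)}"
    using assms by (simp add: block_def w)
  then show ?thesis
    unfolding Pow_insert Pow_empty image_insert image_empty block_def w prod.case Un_insert_left
      Un_empty_left insert_iff
    by (elim disjE)
      (simp_all add: num_tilings_insert pair_in_cell_dominoes insert_Diff_if numeral_eq_Suc)
qed

text \<open>Each of the \<open>2 * Suc m\<close> columns gains one cell at its top, at height
  \<open>k i\<close>, and one at its bottom, at height \<open>- 1 - k i\<close>. The two are mirror
  images in the horizontal axis.\<close>

lemma card_aztec_cells_Suc: "card (aztec_cells (Suc m)) = card (aztec_cells m) + 4 * Suc m"
proof -
  define I where "I = {- int (Suc m)..int m}"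
  define k where "k i = (if i \<ge> 0 then int m - i else int m + 1 + i)" for i
  have "aztec_cells (Suc m) = aztec_cells m \<union> ((\<lambda>i. (i, k i)) ` I \<union> (\<lambda>i. (i, - 1 - k i)) ` I)"
  proof -
    have "(i, j) \<in> aztec_cells (Suc m) \<longleftrightarrow>
        (i, j) \<in> aztec_cells m \<or> i \<in> I \<and> (j = k i \<or> j = - 1 - k i)" for i j
      unfolding aztec_cells_def I_def k_def by (simp, arith)
    then show ?thesis
      by auto
  qed
  moreover have "aztec_cells m \<inter> ((\<lambda>i. (i, k i)) ` I \<union> (\<lambda>i. (i, - 1 - k i)) ` I) = {}"
    unfolding aztec_cells_def I_def k_def by (auto split: if_splits)
  ultimately have "card (aztec_cells (Suc m)) =
      card (aztec_cells m) + card ((\<lambda>i. (i, k i)) ` I \<union> (\<lambda>i. (i, - 1 - k i)) ` I)"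
    using finite_aztec_cells[of m] by (simp add: card_Un_disjoint I_def)
  moreover have "(\<lambda>i. (i, k i)) ` I \<inter> (\<lambda>i. (i, - 1 - k i)) ` I = {}"
    unfolding I_def k_def by (auto split: if_splits)
  then have "card ((\<lambda>i. (i, k i)) ` I \<union> (\<lambda>i. (i, - 1 - k i)) ` I) = card I + card I"
    by (simp add: card_Un_disjoint card_image inj_on_def I_def)
  moreover have "card I = 2 * Suc m"
    by (simp add: I_def)
  ultimately show ?thesis
    by simp
qed

lemma aztec_cells_mono: "aztec_cells m \<subseteq> aztec_cells (Suc m)"
  by (auto simp: aztec_cells_def)

text \<open>A domino is a half of exactly two blocks, centred at the two ends of the unit segment
  between its cells. These ends are adjacent lattice points, so exactly one of them has the right
  parity.\<close>

lemma domino_in_unique_block: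
  assumes "d \<in> cell_dominoes" "d \<subseteq> aztec_cells (Suc m)"
  shows "\<exists>!w. w \<in> centers m \<and> d \<subseteq> block w"
proof -
  from assms(1) consider i j where "d = {(i, j), (i + 1, j)}" | i j where "d = {(i, j), (i, j + 1)}"
    by (auto simp: cell_dominoes_def)
  then show ?thesis
  proof cases
    case 1
    have le: "\<bar>2 * i + 1\<bar> + \<bar>2 * j + 1\<bar> \<le> 2 * int m + 2" "\<bar>2 * i + 3\<bar> + \<bar>2 * j + 1\<bar> \<le> 2 * int m + 2"
      using assms(2) by (auto simp: 1 aztec_cells_def)
    have sub: "d \<subseteq> block (x, y) \<longleftrightarrow> x = i + 1 \<and> (y = j \<or> y = j + 1)" for x y
      by (auto simp: 1 block_def)
    show ?thesis
    proof (cases "even (i + 1 + j + int m)")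
      case True
      have "(i + 1, j) \<in> centers m"
        using le True by (subst in_centers_iff_even) (linarith, simp add: ac_simps)
      then show ?thesis
        using True by (intro ex1I[of _ "(i + 1, j)"]) (auto simp: sub centers_def)
    next
      case False
      have "(i + 1, j + 1) \<in> centers m"
        using le False by (subst in_centers_iff_even) (linarith, simp add: ac_simps)
      then show ?thesis
        using False by (intro ex1I[of _ "(i + 1, j + 1)"]) (auto simp: sub centers_def)
    qed
  next
    case 2
    have le: "\<bar>2 * i + 1\<bar> + \<bar>2 * j + 1\<bar> \<le> 2 * int m + 2" "\<bar>2 * i + 1\<bar> + \<bar>2 * j + 3\<bar> \<le> 2 * int m + 2"
      using assms(2) by (auto simp: 2 aztec_cells_def)
    have sub: "d \<subseteq> block (x, y) \<longleftrightarrow> (x = i \<or> x = i + 1) \<and> y = j + 1" for x y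
      by (auto simp: 2 block_def)
    show ?thesis
    proof (cases "even (i + j + 1 + int m)")
      case True
      have "(i, j + 1) \<in> centers m"
        using le True by (subst in_centers_iff_even) (linarith, simp add: ac_simps)
      then show ?thesis
        using True by (intro ex1I[of _ "(i, j + 1)"]) (auto simp: sub centers_def)
    next
      case False
      have "(i + 1, j + 1) \<in> centers m"
        using le False by (subst in_centers_iff_even) (linarith, simp add: ac_simps)
      then show ?thesis
        using False by (intro ex1I[of _ "(i + 1, j + 1)"]) (auto simp: sub centers_def)
    qed
  qed
qed

lemma block_subset_aztec_cells: "w \<in> centers m \<Longrightarrow> block w \<subseteq> aztec_cells (Suc m)"
proof (rule subsetI)
  fix c assume w: "w \<in> centers m" and c: "c \<in> block w"
  obtain x y i j where eq: "w = (x, y)" "c = (i, j)" by (cases w, cases c)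
  have "i = x - 1 \<or> i = x" "j = y - 1 \<or> j = y"
    using c by (auto simp: eq block_def)
  then have "\<bar>2 * i + 1\<bar> \<le> 2 * \<bar>x\<bar> + 1" "\<bar>2 * j + 1\<bar> \<le> 2 * \<bar>y\<bar> + 1"
    by linarith+
  moreover have "\<bar>x\<bar> + \<bar>y\<bar> \<le> int m"
    using w by (simp add: eq centers_def)
  ultimately show "c \<in> aztec_cells (Suc m)"
    by (simp add: eq aztec_cells_def)
qed

text \<open>The blocks containing a cell are centred at its four corners. Opposite corners have
  equal parity and adjacent ones different parity, so two corners qualify;
  \<open>in_centers_iff_even\<close> applies to all four, as the cell lies in
  \<open>aztec_cells m\<close>.\<close>

lemma inner_cell_in_two_blocks:
  assumes "c \<in> aztec_cells m"
  obtains v w where "v \<noteq> w" "{u \<in> centers m. c \<in> block u} = {v, w}"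
proof -
  obtain i j where c: "c = (i, j)" by (cases c)
  have le: "\<bar>2 * i + 1\<bar> + \<bar>2 * j + 1\<bar> \<le> 2 * int m"
    using assms by (simp add: c aztec_cells_def)
  have mem: "c \<in> block (x, y) \<longleftrightarrow> (x = i \<or> x = i + 1) \<and> (y = j \<or> y = j + 1)" for x y
    by (auto simp: c block_def)
  have in_centers: "(x, y) \<in> centers m \<longleftrightarrow> even (x + y + int m)"
    if "x = i \<or> x = i + 1" "y = j \<or> y = j + 1" for x y
    using that le by (intro in_centers_iff_even) linarith
  show ?thesis
  proof (cases "even (i + j + int m)")
    case True
    have "{u \<in> centers m. c \<in> block u} = {(i, j), (i + 1, j + 1)}"
      using True in_centers by (auto simp: mem)
    then show ?thesis
      by (rule that[rotated]) simp
  next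
    case False
    have "{u \<in> centers m. c \<in> block u} = {(i + 1, j), (i, j + 1)}"
      using False in_centers by (auto simp: mem)
    then show ?thesis
      by (rule that[rotated]) simp
  qed
qed

text \<open>For a cell of the outer layer, the corner nearest to the origin has
  \<open>\<bar>x\<bar> + \<bar>y\<bar> = m\<close>, hence the right parity, while the other three
  corners violate the bound.\<close>

lemma outer_cell_in_one_block:
  assumes "c \<in> aztec_cells (Suc m)" "c \<notin> aztec_cells m"
  obtains v where "{u \<in> centers m. c \<in> block u} = {v}"
proof -
  obtain i j where c: "c = (i, j)" by (cases c)
  have eq: "\<bar>2 * i + 1\<bar> + \<bar>2 * j + 1\<bar> = 2 * int m + 2"
    using assms unfolding c aztec_cells_def by (simp, presburger)
  have mem: "c \<in> block (x, y) \<longleftrightarrow> (x = i \<or> x = i + 1) \<and> (y = j \<or> y = j + 1)" for x y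
    by (auto simp: c block_def)
  define x where "x = (if i \<ge> 0 then i else i + 1)"
  define y where "y = (if j \<ge> 0 then j else j + 1)"
  have "(x', y') \<in> centers m \<longleftrightarrow> x' = x \<and> y' = y"
    if "x' = i \<or> x' = i + 1" "y' = j \<or> y' = j + 1" for x' y'
  proof -
    have xy: "\<bar>x\<bar> + \<bar>y\<bar> = int m"
      using eq unfolding x_def y_def by (simp split: if_split, arith)
    then have "(x, y) \<in> centers m"
      by (subst in_centers_iff_even) (simp, metis even_abs_add_iff add.commute even_add)
    moreover have "\<bar>x'\<bar> \<ge> \<bar>x\<bar> + (if x' = x then 0 else 1)" "\<bar>y'\<bar> \<ge> \<bar>y\<bar> + (if y' = y then 0 else 1)"
      using that unfolding x_def y_def by (auto split: if_splits)
    then have "x' = x \<and> y' = y" if "\<bar>x'\<bar> + \<bar>y'\<bar> \<le> int m"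
      using xy that by (auto split: if_splits)
    then have "x' = x \<and> y' = y" if "(x', y') \<in> centers m"
      using that unfolding centers_def by blast
    ultimately show ?thesis
      by blast
  qed
  moreover have "x = i \<or> x = i + 1" "y = j \<or> y = j + 1"
    by (auto simp: x_def y_def)
  ultimately have "{u \<in> centers m. c \<in> block u} = {(x, y)}"
    by (auto simp: mem)
  then show ?thesis
    by (rule that)
qed

section \<open>Exchanging the covers of consecutive Aztec diamonds\<close>

definition block_covers :: "nat \<Rightarrow> cell set \<Rightarrow> (int \<times> int \<Rightarrow> cell set) set" where
  "block_covers m F = {t. t \<in> (\<Pi>\<^sub>E w\<in>centers m. Pow (block w)) \<and>
     disjoint_family_on t (centers m) \<and> (\<Union>w\<in>centers m. t w) = F}"

text \<open>Disjointness and union are restated cell by cell, through the set of blocks that use a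
  given cell. In this form the effect of complementation can be read off.\<close>

lemma block_covers_iff:
  "t \<in> block_covers m F \<longleftrightarrow> t \<in> (\<Pi>\<^sub>E w\<in>centers m. Pow (block w)) \<and>
     (\<forall>c\<in>F. \<exists>w. {u \<in> centers m. c \<in> t u} = {w}) \<and> (\<forall>c. c \<notin> F \<longrightarrow> {u \<in> centers m. c \<in> t u} = {})"
proof -
  have "disjoint_family_on t (centers m) \<and> (\<Union>w\<in>centers m. t w) = F \<longleftrightarrow>
     (\<forall>c\<in>F. \<exists>w. {u \<in> centers m. c \<in> t u} = {w}) \<and> (\<forall>c. c \<notin> F \<longrightarrow> {u \<in> centers m. c \<in> t u} = {})"
    (is "?L \<longleftrightarrow> ?R")
  proof
    assume L: ?L
    have sing: "{u \<in> centers m. c \<in> t u} = {w}" if "w \<in> centers m" "c \<in> t w" for c w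
      using L that unfolding disjoint_family_on_def by blast
    show ?R
    proof (intro conjI ballI allI impI)
      fix c assume "c \<in> F"
      then obtain w where "w \<in> centers m" "c \<in> t w"
        using L by blast
      then show "\<exists>w. {u \<in> centers m. c \<in> t u} = {w}"
        using sing by blast
    next
      fix c assume "c \<notin> F"
      then show "{u \<in> centers m. c \<in> t u} = {}"
        using L by blast
    qed
  next
    assume R: ?R
    have F: "c \<in> F" if "w \<in> centers m" "c \<in> t w" for c w
    proof (rule ccontr)
      assume "c \<notin> F"
      then have "{u \<in> centers m. c \<in> t u} = {}"
        using R by meson
      then show False
        using that by blast
    qed
    have ex: "\<exists>w\<in>centers m. c \<in> t w" if cF: "c \<in> F" for c
    proof -
      obtain w where "{u \<in> centers m. c \<in> t u} = {w}"
        using R cF by meson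
      then have "w \<in> {u \<in> centers m. c \<in> t u}"
        by simp
      then show ?thesis
        by blast
    qed
    have "t v \<inter> t w = {}" if "v \<in> centers m" "w \<in> centers m" "v \<noteq> w" for v w
    proof (rule equals0I)
      fix c assume c: "c \<in> t v \<inter> t w"
      then have "c \<in> F"
        using F that by blast
      then obtain z where "{u \<in> centers m. c \<in> t u} = {z}"
        using R by meson
      moreover have "v \<in> {u \<in> centers m. c \<in> t u}" "w \<in> {u \<in> centers m. c \<in> t u}"
        using c that by simp_all
      ultimately show False
        using that(3) by simp
    qed
    moreover have "(\<Union>w\<in>centers m. t w) = F"
      using F ex by blast
    ultimately show ?L
      by (simp add: disjoint_family_on_def)
  qed
  then show ?thesis
    by (simp add: block_covers_def)
qed

text \<open>The restriction keeps the function extensional, so that complementing twice returns the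
  original cover and not merely one that agrees with it on \<open>centers m\<close>.\<close>

definition complement_cover :: "nat \<Rightarrow> (int \<times> int \<Rightarrow> cell set) \<Rightarrow> int \<times> int \<Rightarrow> cell set" where
  "complement_cover m t = restrict (\<lambda>w. block w - t w) (centers m)"

lemma complement_cover_swaps:
  assumes FG: "F = aztec_cells (Suc m) \<and> G = aztec_cells m \<or> F = aztec_cells m \<and> G = aztec_cells (Suc m)"
    and t: "t \<in> block_covers m F"
  shows "complement_cover m t \<in> block_covers m G"
    and "complement_cover m (complement_cover m t) = t"
proof -
  have P: "t \<in> (\<Pi>\<^sub>E w\<in>centers m. Pow (block w))"
    and one: "\<And>c. c \<in> F \<Longrightarrow> \<exists>w. {u \<in> centers m. c \<in> t u} = {w}"
    and none: "\<And>c. c \<notin> F \<Longrightarrow> {u \<in> centers m. c \<in> t u} = {}"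
    using t by (auto simp: block_covers_iff)
  have sub: "t w \<subseteq> block w" if "w \<in> centers m" for w
    using P that by auto
  have comp: "{u \<in> centers m. c \<in> complement_cover m t u} =
      {u \<in> centers m. c \<in> block u} - {u \<in> centers m. c \<in> t u}" for c
    by (auto simp: complement_cover_def)
  have le: "{u \<in> centers m. c \<in> t u} \<subseteq> {u \<in> centers m. c \<in> block u}" for c
    using sub by blast
  have "(c \<in> G \<longrightarrow> (\<exists>w. {u \<in> centers m. c \<in> complement_cover m t u} = {w})) \<and>
      (c \<notin> G \<longrightarrow> {u \<in> centers m. c \<in> complement_cover m t u} = {})" for c
  proof -
    consider "c \<in> aztec_cells m" | "c \<in> aztec_cells (Suc m)" "c \<notin> aztec_cells m"
      | "c \<notin> aztec_cells (Suc m)"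
      by blast
    then show ?thesis
    proof cases
      case 1
      then have "c \<in> F" "c \<in> G"
        using FG aztec_cells_mono by blast+
      obtain v w where vw: "v \<noteq> w" "{u \<in> centers m. c \<in> block u} = {v, w}"
        using inner_cell_in_two_blocks[OF 1] .
      obtain z where z: "{u \<in> centers m. c \<in> t u} = {z}"
        using one[OF \<open>c \<in> F\<close>] by meson
      have "z = v \<or> z = w"
        using le[of c] unfolding vw z by simp
      then have "\<exists>z. {u \<in> centers m. c \<in> complement_cover m t u} = {z}"
        unfolding comp vw z using vw(1) by (auto simp: insert_Diff_if)
      then show ?thesis
        using \<open>c \<in> G\<close> by blast
    next
      case 2
      obtain v where v: "{u \<in> centers m. c \<in> block u} = {v}"
        using outer_cell_in_one_block[OF 2] .
      show ?thesis
      proof (cases "c \<in> F")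
        case True
        then have "c \<notin> G" using FG 2 by blast
        obtain z where z: "{u \<in> centers m. c \<in> t u} = {z}"
          using one[OF True] by meson
        have "{u \<in> centers m. c \<in> complement_cover m t u} = {}"
          using le[of c] unfolding comp v z by simp
        then show ?thesis using \<open>c \<notin> G\<close> by blast
      next
        case False
        then have "c \<in> G" using FG 2 by blast
        have "{u \<in> centers m. c \<in> complement_cover m t u} = {v}"
          unfolding comp v none[OF False] by simp
        then show ?thesis using \<open>c \<in> G\<close> by blast
      qed
    next
      case 3
      then have "c \<notin> G" using FG aztec_cells_mono by blast
      moreover have "{u \<in> centers m. c \<in> block u} = {}"
        using 3 block_subset_aztec_cells by blast
      ultimately show ?thesis
        unfolding comp by blast
    qed
  qed
  moreover have "complement_cover m t \<in> (\<Pi>\<^sub>E w\<in>centers m. Pow (block w))"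
    by (auto simp: complement_cover_def)
  ultimately show "complement_cover m t \<in> block_covers m G"
    unfolding block_covers_iff by blast
  show "complement_cover m (complement_cover m t) = t"
  proof (rule extensionalityI[where A = "centers m"])
    show "t \<in> extensional (centers m)"
      using P by (simp add: PiE_iff)
    show "complement_cover m (complement_cover m t) w = t w" if "w \<in> centers m" for w
      using sub[OF that] that by (auto simp: complement_cover_def)
  qed (simp add: complement_cover_def)
qed

text \<open>The smaller diamond is contained in the larger one, so the same blocks serve both. This
  makes the two sums comparable term by term.\<close>

lemma num_tilings_eq_sum_covers:
  assumes "F = aztec_cells (Suc m) \<or> F = aztec_cells m"
  shows "num_tilings F = (\<Sum>t\<in>block_covers m F. \<Prod>w\<in>centers m. num_tilings (t w))"
  unfolding block_covers_def
proof (rule num_tilings_blocks[OF finite_centers _ finite_block domino_in_unique_block])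
  show "finite F"
    using assms finite_aztec_cells by blast
  show "d \<subseteq> aztec_cells (Suc m)" if "d \<subseteq> F" for d
    using that assms aztec_cells_mono by blast
qed

lemma card_block_cover:
  assumes "t \<in> block_covers m F"
  shows "(\<Sum>w\<in>centers m. card (t w)) = card F"
proof -
  have "finite (t w)" if "w \<in> centers m" for w
    using assms that finite_block[of w] by (auto simp: block_covers_def intro: finite_subset)
  then have "card (\<Union>w\<in>centers m. t w) = (\<Sum>w\<in>centers m. card (t w))"
    using assms finite_centers by (intro card_UN_disjoint) (auto simp: block_covers_def disjoint_family_on_def)
  then show ?thesis
    using assms by (simp add: block_covers_def)
qed

text \<open>In the product of the identities \<open>num_tilings_block_complement\<close> over all
  blocks, the exponents of 2 add up to the cell numbers of the two diamonds. The resulting factor is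
  therefore the same for every cover.\<close>

lemma prod_complement_cover:
  assumes t: "t \<in> block_covers m (aztec_cells m)"
  shows "(\<Prod>w\<in>centers m. num_tilings (complement_cover m t w)) =
    2 ^ Suc m * (\<Prod>w\<in>centers m. num_tilings (t w))" (is "?A = _ * ?B")
proof -
  have sub: "t w \<subseteq> block w" if "w \<in> centers m" for w
    using t that by (auto simp: block_covers_def)
  have s: "complement_cover m t \<in> block_covers m (aztec_cells (Suc m))"
    using complement_cover_swaps(1) t by blast
  have "?A ^ 4 * 2 ^ card (aztec_cells m) =
      (\<Prod>w\<in>centers m. num_tilings (complement_cover m t w) ^ 4 * 2 ^ card (t w))"
    by (simp add: prod.distrib prod_power_distrib power_sum card_block_cover[OF t, symmetric])
  also have "\<dots> = (\<Prod>w\<in>centers m. num_tilings (t w) ^ 4 * 2 ^ card (complement_cover m t w))"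
    using num_tilings_block_complement[OF sub] by (intro prod.cong) (auto simp: complement_cover_def)
  also have "\<dots> = ?B ^ 4 * 2 ^ card (aztec_cells (Suc m))"
    by (simp add: prod.distrib prod_power_distrib power_sum card_block_cover[OF s, symmetric])
  \<comment> \<open>The \<open>4 * Suc m\<close> additional cells supply the fourth power of
    \<open>2 ^ Suc m\<close>.\<close>
  finally have "?A ^ 4 * 2 ^ card (aztec_cells m) = (2 ^ Suc m * ?B) ^ 4 * 2 ^ card (aztec_cells m)"
    unfolding card_aztec_cells_Suc
    by (simp only: power_add power_mult_distrib power_mult[symmetric] mult_ac)
  then have "?A ^ 4 = (2 ^ Suc m * ?B) ^ 4"
    by simp
  then show ?thesis
    by (rule power_eq_imp_eq_base) auto
qed

lemma num_tilings_aztec_Suc: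
  "num_tilings (aztec_cells (Suc m)) = 2 ^ Suc m * num_tilings (aztec_cells m)"
proof -
  have "num_tilings (aztec_cells (Suc m)) =
      (\<Sum>t\<in>block_covers m (aztec_cells (Suc m)). \<Prod>w\<in>centers m. num_tilings (t w))"
    by (rule num_tilings_eq_sum_covers) simp
  also have "\<dots> = (\<Sum>t\<in>block_covers m (aztec_cells m). \<Prod>w\<in>centers m. num_tilings (complement_cover m t w))"
    by (rule sum.reindex_bij_witness[where i = "complement_cover m" and j = "complement_cover m"])
      (use complement_cover_swaps[of "aztec_cells (Suc m)" m "aztec_cells m"]
        complement_cover_swaps[of "aztec_cells m" m "aztec_cells (Suc m)"] in auto)
  also have "\<dots> = (\<Sum>t\<in>block_covers m (aztec_cells m). 2 ^ Suc m * (\<Prod>w\<in>centers m. num_tilings (t w)))"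
    using prod_complement_cover by (intro sum.cong) auto
  also have "\<dots> = 2 ^ Suc m * num_tilings (aztec_cells m)"
    using num_tilings_eq_sum_covers[of "aztec_cells m" m] by (simp add: sum_distrib_left)
  finally show ?thesis .
qed

lemma num_tilings_aztec: "num_tilings (aztec_cells n) = 2 ^ (n * (n + 1) div 2)"
proof (induction n)
  case 0
  have "aztec_cells 0 = {}"
    unfolding aztec_cells_def by (auto, presburger)
  then show ?case
    by simp
next
  case (Suc n)
  have "Suc n * (Suc n + 1) div 2 = Suc n + n * (n + 1) div 2"
  proof -
    have "Suc n * (Suc n + 1) = 2 * Suc n + n * (n + 1)"
      by simp
    then show ?thesis
      by (simp only:) simp
  qed
  then show ?case
    using Suc by (simp only: num_tilings_aztec_Suc power_add)
qed


section \<open>The recursion for \<open>C\<close>\<close>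

text \<open>The integers are viewed as the free abelian group on one generator \<open>()\<close>, so
  additivity is inherited from \<open>frag_extend\<close>.\<close>

lemma lin_extend_eq_lookup:
  "lin_extend f x = Poly_Mapping.lookup (frag_extend (\<lambda>a. frag_cmul (f a) (frag_of ())) x) ()"
  by (simp add: lin_extend_def frag_extend_def lookup_sum)

lemma lin_extend_0 [simp]: "lin_extend f 0 = 0"
  by (simp add: lin_extend_def)

lemma lin_extend_frag_of [simp]: "lin_extend f (frag_of a) = f a"
  by (simp add: lin_extend_def)

lemma lin_extend_add: "lin_extend f (x + y) = lin_extend f x + lin_extend f y"
  by (simp add: lin_extend_eq_lookup frag_extend_add lookup_add)

lemma lin_extend_diff: "lin_extend f (x - y) = lin_extend f x - lin_extend f y"
  by (simp add: lin_extend_eq_lookup frag_extend_diff lookup_minus)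

lemma lin_extend_frag_extend:
  "lin_extend f (frag_extend g x) = lin_extend (\<lambda>a. lin_extend f (g a)) x"
proof -
  have "Poly_Mapping.keys x \<subseteq> UNIV" by simp
  then show ?thesis
    by (induction x rule: frag_induction) (simp_all add: frag_extend_diff lin_extend_diff)
qed

section \<open>Peeling off the first entry of a sequence\<close>

definition prepend :: "bool \<Rightarrow> (bool list \<Rightarrow>\<^sub>0 int) \<Rightarrow> (bool list \<Rightarrow>\<^sub>0 int)" where
  "prepend a = frag_extend (\<lambda>\<eta>. frag_of (a # \<eta>))"

text \<open>Counted from 1, \<open>Ei_op (Suc i)\<close> involves only the entries
  \<open>i + 1\<close> and \<open>i + 2\<close>. These are the entries \<open>i\<close> and
  \<open>i + 1\<close> of the tail.\<close>

lemma Ei_op_prepend: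
  assumes "i \<ge> 1"
  shows "Ei_op (Suc i) (prepend a x) = prepend a (Ei_op i x)"
proof -
  obtain k where i: "i = Suc k"
    using assms by (cases i) auto
  have "Poly_Mapping.keys x \<subseteq> UNIV" by simp
  then show ?thesis
  proof (induction x rule: frag_induction)
    case (one \<eta>)
    then show ?case
      by (simp add: Ei_op_def prepend_def Ei_basis_def i frag_extend_add)
  qed (simp_all add: Ei_op_def prepend_def frag_extend_diff)
qed

lemma fold_Ei_op_add: "fold Ei_op is (x + y) = fold Ei_op is x + fold Ei_op is y"
  by (induction "is" arbitrary: x y) (simp_all add: Ei_op_def frag_extend_add)

lemma fold_Ei_op_0: "fold Ei_op is 0 = 0"
  using fold_Ei_op_add[of "is" 0 0] by simp

lemma E_op_0: "E_op m 0 = 0"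
  by (simp add: E_op_def fold_Ei_op_0)

lemma fold_Ei_op_prepend:
  "fold Ei_op [2..<Suc m] (prepend a x) = prepend a (E_op m x)"
proof -
  have "fold Ei_op (map Suc is) (prepend a x) = prepend a (fold Ei_op is x)" if "\<forall>i\<in>set is. i \<ge> 1" for "is"
    using that by (induction "is" arbitrary: x) (simp_all add: Ei_op_prepend)
  from this[of "[1..<m]"] show ?thesis
    by (simp add: E_op_def map_Suc_upt numeral_2_eq_2)
qed

text \<open>The operator with index 1 acts first and may split the sequence in two. The remaining
  operators leave the first entry alone and act on each tail as the shorter
  \<open>E_op\<close>.\<close>

lemma E_op_Cons_Cons:
  "E_op (Suc (Suc m)) (frag_of (a # b # \<eta>)) = prepend a (E_op (Suc m) (frag_of (b # \<eta>))) +
     (if \<not> a \<and> \<not> b then prepend True (E_op (Suc m) (frag_of (True # \<eta>))) else 0)"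
proof -
  have upt: "[1..<Suc (Suc m)] = 1 # [2..<Suc (Suc m)]"
    by (subst upt_conv_Cons) (auto simp: numeral_2_eq_2)
  have pre: "frag_of (a # \<theta>) = prepend a (frag_of \<theta>)" for a \<theta>
    by (simp add: prepend_def)
  have "E_op (Suc (Suc m)) (frag_of (a # b # \<eta>)) = fold Ei_op [2..<Suc (Suc m)]
      (frag_of (a # b # \<eta>) + (if \<not> a \<and> \<not> b then frag_of (True # True # \<eta>) else 0))"
    unfolding E_op_def upt by (simp add: Ei_op_def Ei_basis_def)
  also have "\<dots> = prepend a (E_op (Suc m) (frag_of (b # \<eta>))) +
      (if \<not> a \<and> \<not> b then prepend True (E_op (Suc m) (frag_of (True # \<eta>))) else 0)"
    unfolding pre[of _ "_ # _"] fold_Ei_op_add fold_Ei_op_prepend if_distrib[of "fold Ei_op _"]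
      fold_Ei_op_0 ..
  finally show ?thesis .
qed

text \<open>The value of \<open>f\<close>, extended linearly, on the image of a sequence under
  \<open>E_op\<close>, computed from left to right; the entries already settled are absorbed into
  \<open>f\<close>.\<close>

fun row_sum :: "(bool list \<Rightarrow> int) \<Rightarrow> bool list \<Rightarrow> int" where
  "row_sum f [] = f []"
| "row_sum f [a] = f [a]"
| "row_sum f (a # b # \<eta>) = row_sum (\<lambda>\<delta>. f (a # \<delta>)) (b # \<eta>) +
     (if \<not> a \<and> \<not> b then row_sum (\<lambda>\<delta>. f (True # \<delta>)) (True # \<eta>) else 0)"

lemma lin_extend_E_op: "lin_extend f (E_op (length \<eta>) (frag_of \<eta>)) = row_sum f \<eta>"
proof (induction f \<eta> rule: row_sum.induct)
  case (3 f a b \<eta>)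
  have "lin_extend f (prepend a x) = lin_extend (\<lambda>\<delta>. f (a # \<delta>)) x" for a x
    by (simp add: prepend_def lin_extend_frag_extend)
  then show ?case
    using 3 by (simp add: E_op_Cons_Cons lin_extend_add)
qed (simp_all add: E_op_def)

lemma row_sum_cong:
  "(\<And>\<delta>. length \<delta> = length \<eta> \<Longrightarrow> f \<delta> = g \<delta>) \<Longrightarrow> row_sum f \<eta> = row_sum g \<eta>"
proof (induction f \<eta> arbitrary: g rule: row_sum.induct)
  case (3 f a b \<eta>)
  have "row_sum (\<lambda>\<delta>. f (a # \<delta>)) (b # \<eta>) = row_sum (\<lambda>\<delta>. g (a # \<delta>)) (b # \<eta>)"
    using 3 by simp
  moreover have "row_sum (\<lambda>\<delta>. f (True # \<delta>)) (True # \<eta>) = row_sum (\<lambda>\<delta>. g (True # \<delta>)) (True # \<eta>)"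
    if "\<not> a \<and> \<not> b"
    using 3 that by simp
  ultimately show ?case
    by simp
qed simp_all

text \<open>Outside the vanishing cases, \<open>e \<longrightarrow> e'\<close> is 0 only for (1, 0)
  and \<open>f' \<longrightarrow> f\<close> only for (0, 1), as in \<open>K_basis\<close>. The
  complementation moves into the argument of \<open>row_sum\<close>.\<close>

lemma C_Suc_Suc:
  assumes "length \<mu> = 2 * k"
  shows "C (Suc (Suc k)) (e # e' # \<mu> @ [f, f']) =
    (if \<not> e \<and> e' \<or> f \<and> \<not> f' then 0
     else row_sum (\<lambda>\<delta>. C (Suc k) (map Not \<delta>)) ((e \<longrightarrow> e') # \<mu> @ [f' \<longrightarrow> f]))"
proof -
  let ?\<eta> = "e # e' # \<mu> @ [f, f']"
  have nth: "?\<eta> ! (2 * (k + 2) - 2) = f" "?\<eta> ! (2 * (k + 2) - 1) = f'"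
    using assms by (simp_all add: nth_append)
  have K: "K_op (2 * (k + 2)) (frag_of ?\<eta>) =
      (if \<not> e \<and> e' \<or> f \<and> \<not> f' then 0 else frag_of ((e \<longrightarrow> e') # \<mu> @ [f' \<longrightarrow> f]))"
    unfolding K_op_def frag_extend_of K_basis_def nth using assms by (auto simp: Let_def)
  have len: "length ((e \<longrightarrow> e') # \<mu> @ [f' \<longrightarrow> f]) = 2 * (k + 2) - 2"
    using assms by simp
  have R: "lin_extend g (R_op x) = lin_extend (\<lambda>\<delta>. g (map Not \<delta>)) x" for g x
    by (simp add: R_op_def lin_extend_frag_extend)
  show ?thesis
    unfolding C.simps Let_def K R len[symmetric]
    by (cases "\<not> e \<and> e' \<or> f \<and> \<not> f'")
      (simp_all only: lin_extend_E_op E_op_0 lin_extend_0 if_True if_False)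
qed

section \<open>Scanning a row\<close>

text \<open>The cells \<open>(c + i, h)\<close> with \<open>\<eta> ! i = 0\<close>.\<close>

fun gaps :: "int \<Rightarrow> int \<Rightarrow> bool list \<Rightarrow> cell set" where
  "gaps c h [] = {}"
| "gaps c h (b # \<eta>) = (if b then {} else {(c, h)}) \<union> gaps (c + 1) h \<eta>"

lemma gaps_iff:
  "(x, y) \<in> gaps c h \<eta> \<longleftrightarrow> y = h \<and> c \<le> x \<and> x < c + int (length \<eta>) \<and> \<not> \<eta> ! nat (x - c)"
proof (induction \<eta> arbitrary: c)
  case (Cons b \<eta>)
  have "nat (x - c) = Suc (nat (x - (c + 1)))" if "x > c"
    using that by simp
  then show ?case
    using Cons.IH[of "c + 1"] by (cases "x = c"; cases "x > c") auto
qed auto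

lemma finite_gaps: "finite (gaps c h \<eta>)"
  by (induction \<eta> arbitrary: c) auto

lemma gaps_append: "gaps c h (\<eta> @ \<theta>) = gaps c h \<eta> \<union> gaps (c + int (length \<eta>)) h \<theta>"
  by (induction \<eta> arbitrary: c) (auto simp: ac_simps)

lemma gaps_map_Not: "gaps c h (map Not \<eta>) = {c..<c + int (length \<eta>)} \<times> {h} - gaps c h \<eta>"
proof -
  have "nat (x - c) < length \<eta>" if "c \<le> x" "x < c + int (length \<eta>)" for x
    using that by linarith
  then show ?thesis
    by (auto simp: gaps_iff)
qed

text \<open>
  From here on \<open>s = \<plusminus>1\<close> is the vertical direction pointing away from the cut, so that both
  halves of the Aztec diamond are treated at once.
\<close>

context
  fixes s h :: int and Q :: "cell set"
  assumes s: "\<bar>s\<bar> = 1" and finQ: "finite Q"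
    and row: "\<And>x. (x, h) \<notin> Q" and below: "\<And>x. (x, h - s) \<notin> Q"
begin

lemma neighbor_cases:
  "{(c, h), (x, y)} \<in> cell_dominoes \<longleftrightarrow>
     (x, y) = (c - 1, h) \<or> (x, y) = (c + 1, h) \<or> (x, y) = (c, h + s) \<or> (x, y) = (c, h - s)"
proof -
  have "s = 1 \<or> s = - 1"
    using s by linarith
  then show ?thesis
    unfolding pair_in_cell_dominoes by (elim disjE) auto
qed

text \<open>The row has no gap to the left of \<open>c\<close>, and \<open>Q\<close> has no cell in
  the rows \<open>h\<close> and \<open>h - s\<close>, so two of the four neighbours are
  absent.\<close>

lemma leftmost_gap_neighbor:
  assumes "q \<in> gaps c h (False # \<eta>) \<union> Q"
  shows "{(c, h), q} \<in> cell_dominoes \<longleftrightarrow> q = (c + 1, h) \<or> q = (c, h + s)"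
proof -
  obtain x y where q: "q = (x, y)" by (cases q)
  have "(c - 1, h) \<notin> gaps c h (False # \<eta>) \<union> Q" "(c, h - s) \<notin> gaps c h (False # \<eta>) \<union> Q"
    using row below s by (auto simp: gaps_iff)
  then show ?thesis
    using assms unfolding q neighbor_cases by blast
qed

text \<open>The leftmost gap is covered either by a vertical domino, which removes a cell of
  \<open>Q\<close>, or together with the next cell of the row if that is a gap too.\<close>

lemma num_tilings_first_gap_inner:
  assumes up: "(c, h + s) \<in> Q"
  shows "num_tilings (gaps c h (False # \<eta>) \<union> Q) =
    num_tilings (gaps (c + 1) h \<eta> \<union> (Q - {(c, h + s)})) +
    (if (c + 1, h) \<in> gaps (c + 1) h \<eta> then num_tilings (gaps (c + 1) h \<eta> - {(c + 1, h)} \<union> Q) else 0)"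
    (is "num_tilings ?S = _")
proof -
  have fin: "finite ?S" and p: "(c, h) \<in> ?S" and r: "(c, h + s) \<in> ?S"
    using finQ up by (auto simp: finite_gaps)
  have notin: "(c, h) \<notin> gaps (c + 1) h \<eta>" "(c, h) \<notin> Q" "(c + 1, h) \<notin> Q"
      "(c, h + s) \<notin> gaps (c + 1) h \<eta>"
    using row by (auto simp: gaps_iff)
  have S: "?S = insert (c, h) (gaps (c + 1) h \<eta> \<union> Q)"
    by simp
  have up_eq: "?S - {(c, h), (c, h + s)} = gaps (c + 1) h \<eta> \<union> (Q - {(c, h + s)})"
    unfolding S using notin by blast
  have right_eq: "?S - {(c, h), (c + 1, h)} = gaps (c + 1) h \<eta> - {(c + 1, h)} \<union> Q"
    unfolding S using notin by blast
  show ?thesis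
  proof (cases "(c + 1, h) \<in> gaps (c + 1) h \<eta>")
    case True
    have "num_tilings ?S = num_tilings (?S - {(c, h), (c, h + s)}) + num_tilings (?S - {(c, h), (c + 1, h)})"
      using True leftmost_gap_neighbor by (intro num_tilings_two_ways[OF fin p r]) auto
    then show ?thesis
      unfolding up_eq right_eq using True by simp
  next
    case False
    then have "(c + 1, h) \<notin> ?S"
      unfolding S using notin by auto
    then have "num_tilings ?S = num_tilings (?S - {(c, h), (c, h + s)})"
      using leftmost_gap_neighbor by (intro num_tilings_forced[OF fin p r]) metis
    then show ?thesis
      unfolding up_eq using False by simp
  qed
qed

lemma num_tilings_first_gap_outer:
  assumes up: "(c, h + s) \<notin> Q"
  shows "num_tilings (gaps c h (False # \<eta>) \<union> Q) =
    (if (c + 1, h) \<in> gaps (c + 1) h \<eta> then num_tilings (gaps (c + 1) h \<eta> - {(c + 1, h)} \<union> Q) else 0)"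
    (is "num_tilings ?S = _")
proof -
  have fin: "finite ?S" and p: "(c, h) \<in> ?S"
    using finQ by (auto simp: finite_gaps)
  have notin: "(c, h) \<notin> gaps (c + 1) h \<eta>" "(c, h) \<notin> Q" "(c + 1, h) \<notin> Q"
    using row by (auto simp: gaps_iff)
  have S: "?S = insert (c, h) (gaps (c + 1) h \<eta> \<union> Q)"
    by simp
  have "(c, h + s) \<notin> ?S"
    using up s by (auto simp: gaps_iff)
  then have nb: "{(c, h), q} \<in> cell_dominoes \<longleftrightarrow> q = (c + 1, h)" if "q \<in> ?S" for q
    using leftmost_gap_neighbor[OF that] that by blast
  show ?thesis
  proof (cases "(c + 1, h) \<in> gaps (c + 1) h \<eta>")
    case True
    then have "num_tilings ?S = num_tilings (?S - {(c, h), (c + 1, h)})"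
      using nb by (intro num_tilings_forced[OF fin p]) auto
    moreover have "?S - {(c, h), (c + 1, h)} = gaps (c + 1) h \<eta> - {(c + 1, h)} \<union> Q"
      unfolding S using notin by blast
    ultimately show ?thesis
      using True by simp
  next
    case False
    then have "(c + 1, h) \<notin> ?S"
      unfolding S using notin by auto
    then have "num_tilings ?S = 0"
      using nb by (intro num_tilings_isolated[OF fin p]) metis
    then show ?thesis
      using False by simp
  qed
qed

lemma num_tilings_last_gap_outer:
  assumes up: "(e, h + s) \<notin> Q" and e: "e = c + int (length \<eta>)"
  shows "num_tilings (gaps c h (\<eta> @ [False]) \<union> Q) =
    (if (e - 1, h) \<in> gaps c h \<eta> then num_tilings (gaps c h \<eta> - {(e - 1, h)} \<union> Q) else 0)"
    (is "num_tilings ?S = _")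
proof -
  have S: "?S = insert (e, h) (gaps c h \<eta> \<union> Q)"
    by (simp add: gaps_append e)
  have fin: "finite ?S" and p: "(e, h) \<in> ?S"
    using finQ by (auto simp: finite_gaps S)
  have notin: "(e, h) \<notin> gaps c h \<eta>" "(e, h) \<notin> Q" "(e - 1, h) \<notin> Q"
    using row by (auto simp: gaps_iff e)
  have "(e + 1, h) \<notin> ?S" "(e, h + s) \<notin> ?S" "(e, h - s) \<notin> ?S"
    using up s row below by (auto simp: gaps_iff e S)
  then have nb: "{(e, h), q} \<in> cell_dominoes \<longleftrightarrow> q = (e - 1, h)" if "q \<in> ?S" for q
    using neighbor_cases[of e "fst q" "snd q"] that by auto
  show ?thesis
  proof (cases "(e - 1, h) \<in> gaps c h \<eta>")
    case True
    then have "num_tilings ?S = num_tilings (?S - {(e, h), (e - 1, h)})"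
      using nb by (intro num_tilings_forced[OF fin p]) (auto simp: S)
    moreover have "?S - {(e, h), (e - 1, h)} = gaps c h \<eta> - {(e - 1, h)} \<union> Q"
      unfolding S using notin by blast
    ultimately show ?thesis
      using True by simp
  next
    case False
    then have "(e - 1, h) \<notin> ?S"
      unfolding S using notin by auto
    then have "num_tilings ?S = 0"
      using nb by (intro num_tilings_isolated[OF fin p]) metis
    then show ?thesis
      using False by simp
  qed
qed

text \<open>With no cell of \<open>Q\<close> next to the end cell, an uncovered end cell forces a
  horizontal domino. This is impossible for (0, 1) and covers the second cell for (0, 0); a covered
  end cell is just dropped. These are the cases of \<open>K_basis\<close> at the left end.\<close>

lemma num_tilings_left_end:
  assumes up: "(c, h + s) \<notin> Q"
  shows "num_tilings (gaps c h (e # e' # \<eta>) \<union> Q) =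
    (if \<not> e \<and> e' then 0 else num_tilings (gaps (c + 1) h ((e \<longrightarrow> e') # \<eta>) \<union> Q))"
proof (cases e)
  case False
  have "(c + 1, h) \<notin> gaps (c + 1 + 1) h \<eta>"
    by (simp add: gaps_iff)
  then show ?thesis
    unfolding num_tilings_first_gap_outer[OF up] using False
    by (simp add: num_tilings_first_gap_outer[OF up] del: gaps.simps) simp
qed simp

lemma num_tilings_right_end:
  assumes up: "(c + int (length \<eta>) + 1, h + s) \<notin> Q"
  shows "num_tilings (gaps c h (\<eta> @ [f, f']) \<union> Q) =
    (if f \<and> \<not> f' then 0 else num_tilings (gaps c h (\<eta> @ [f' \<longrightarrow> f]) \<union> Q))"
proof (cases f')
  case False
  have "(c + int (length \<eta>), h) \<notin> gaps c h \<eta>"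
    by (simp add: gaps_iff)
  moreover have "num_tilings (gaps c h ((\<eta> @ [f]) @ [False]) \<union> Q) =
    (if (c + int (length \<eta>), h) \<in> gaps c h (\<eta> @ [f])
     then num_tilings (gaps c h (\<eta> @ [f]) - {(c + int (length \<eta>), h)} \<union> Q) else 0)"
    by (subst num_tilings_last_gap_outer[of "c + int (length \<eta>) + 1"]) (use up in auto)
  ultimately show ?thesis
    using False by (simp add: gaps_append)
qed (simp add: gaps_append)

end

text \<open>The sequence \<open>\<delta>\<close> marks the cells covered beforehand or by horizontal
  dominoes; each remaining gap sends a vertical domino into the next row. The recursion of
  \<open>row_sum\<close> follows the choice at the leftmost gap. \<open>Q\<close> varies in the
  induction because vertical dominoes use up its cells.\<close>

lemma num_tilings_row:
  assumes s: "\<bar>s\<bar> = 1"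
    and "finite Q" "\<And>x. (x, h) \<notin> Q" "\<And>x. (x, h - s) \<notin> Q"
    and "\<And>x. c \<le> x \<Longrightarrow> x < c + int (length \<eta>) \<Longrightarrow> (x, h + s) \<in> Q"
  shows "int (num_tilings (gaps c h \<eta> \<union> Q)) =
    row_sum (\<lambda>\<delta>. int (num_tilings (Q - gaps c (h + s) \<delta>))) \<eta>"
  using assms(2-)
proof (induction \<eta> arbitrary: c Q rule: measure_induct_rule[of length])
  case (less \<eta>)
  note inner = num_tilings_first_gap_inner[OF s less.prems(1-3)]
  consider "\<eta> = []" | a where "\<eta> = [a]" | a b r where "\<eta> = a # b # r"
    by (metis list.exhaust)
  then show ?case
  proof cases
    case (2 a)
    note \<eta> = this
    have "(c, h + s) \<in> Q"
      using less.prems(4)[of c] by (simp add: \<eta>)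
    then show ?thesis
      using inner[of c "[]"] by (cases a) (simp_all add: \<eta>)
  next
    case (3 a b r)
    note \<eta> = this
    \<comment> \<open>Of the two regions, the smaller one belongs to a vertical domino in column
      \<open>c\<close>. The cell removed lies outside the columns still to be scanned, so the
      hypothesis on the next row persists.\<close>
    have IH: "int (num_tilings (gaps (c + 1) h \<theta> \<union> P)) =
        row_sum (\<lambda>\<delta>. int (num_tilings (P - gaps (c + 1) (h + s) \<delta>))) \<theta>"
      if "length \<theta> = Suc (length r)" "P = Q \<or> P = Q - {(c, h + s)}" for \<theta> P
      using that less.prems by (intro less.IH) (auto simp: \<eta>)
    show ?thesis
    proof (cases a)
      case True
      then show ?thesis
        using IH[of "b # r" Q] by (simp add: \<eta>)
    next
      case False
      have up: "(c, h + s) \<in> Q"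
        using less.prems(4)[of c] by (simp add: \<eta>)
      have notin: "(c + 1, h) \<notin> gaps (c + 1 + 1) h r"
        by (simp add: gaps_iff)
      have "int (num_tilings (gaps c h \<eta> \<union> Q)) =
          int (num_tilings (gaps (c + 1) h (b # r) \<union> (Q - {(c, h + s)}))) +
          (if b then 0 else int (num_tilings (gaps (c + 1) h (True # r) \<union> Q)))"
        using inner[OF up, of "b # r"] False notin by (simp add: \<eta>)
      also have "\<dots> = row_sum (\<lambda>\<delta>. int (num_tilings (Q - gaps c (h + s) \<delta>))) \<eta>"
      proof -
        have "Q - gaps c (h + s) (False # \<delta>) = Q - {(c, h + s)} - gaps (c + 1) (h + s) \<delta>"
          "Q - gaps c (h + s) (True # \<delta>) = Q - gaps (c + 1) (h + s) \<delta>" for \<delta>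
          by auto
        then show ?thesis
          using False IH[of "b # r" "Q - {(c, h + s)}"] IH[of "True # r" Q]
          by (simp add: \<eta> del: gaps.simps(2))
      qed
      finally show ?thesis .
    qed
  qed simp
qed


section \<open>The two halves of the Aztec diamond\<close>

text \<open>The row at height \<open>h\<close> is the widest, next to the cut; each further row, in
  direction \<open>s\<close>, is shorter by one cell at both ends.\<close>

primrec half :: "int \<Rightarrow> nat \<Rightarrow> int \<Rightarrow> cell set" where
  "half s 0 h = {}"
| "half s (Suc m) h = {- int (Suc m)..<int (Suc m)} \<times> {h} \<union> half s m (h + s)"

lemma finite_half: "finite (half s m h)"
  by (induction m arbitrary: h) auto

lemma half_iff:
  assumes "\<bar>s\<bar> = 1"
  shows "(x, y) \<in> half s m h \<longleftrightarrow> s * (y - h) \<ge> 0 \<and> \<bar>2 * x + 1\<bar> + 2 * (s * (y - h)) + 1 \<le> 2 * int m"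
proof (induction m arbitrary: h)
  case 0
  then show ?case by auto
next
  case (Suc m)
  have "s * s = 1"
    using assms by (simp add: abs_if split: if_splits)
  then have "s * (y - (h + s)) = s * (y - h) - 1"
    by (simp add: algebra_simps)
  then have step: "(x, y) \<in> half s (Suc m) h \<longleftrightarrow> y = h \<and> \<bar>2 * x + 1\<bar> + 1 \<le> 2 * int m + 2 \<or>
      s * (y - h) \<ge> 1 \<and> \<bar>2 * x + 1\<bar> + 2 * (s * (y - h)) + 1 \<le> 2 * int m + 2"
    by (simp add: Suc abs_if) linarith
  have "y = h \<longleftrightarrow> s * (y - h) = 0"
    using assms by auto
  then have step': "(x, y) \<in> half s (Suc m) h \<longleftrightarrow> u = 0 \<and> \<bar>2 * x + 1\<bar> + 1 \<le> 2 * int m + 2 \<or>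
      u \<ge> 1 \<and> \<bar>2 * x + 1\<bar> + 2 * u + 1 \<le> 2 * int m + 2" if "u = s * (y - h)" for u
    unfolding that step by simp
  have "u = 0 \<and> v + 1 \<le> 2 * int m + 2 \<or> u \<ge> 1 \<and> v + 2 * u + 1 \<le> 2 * int m + 2 \<longleftrightarrow>
      u \<ge> 0 \<and> v + 2 * u + 1 \<le> 2 * int (Suc m)" for u v :: int
    by (cases "u = 0") auto
  then show ?case
    unfolding step'[OF refl] .
qed

lemma half_rows:
  assumes "\<bar>s\<bar> = 1" "k > 0"
  shows "(x, h - k * s) \<notin> half s m h"
proof -
  have "s * s = 1"
    using assms by (simp add: abs_if split: if_splits)
  then have "s * (h - k * s - h) = - k"
    by (simp add: algebra_simps)
  then show ?thesis
    using assms(2) unfolding half_iff[OF assms(1)] by linarith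
qed

text \<open>Removing the gaps from the full first row leaves the gaps of the complementary sequence.
  This is the geometric counterpart of \<open>R_op\<close>.\<close>

lemma half_minus_gaps:
  assumes "\<bar>s\<bar> = 1" "length \<eta> = 2 * Suc m"
  shows "half s (Suc m) h - gaps (- int (Suc m)) h \<eta> =
    gaps (- int (Suc m)) h (map Not \<eta>) \<union> half s m (h + s)"
proof -
  have "half s m (h + s) \<inter> gaps (- int (Suc m)) h \<eta> = {}"
    using half_rows[OF assms(1), of 1 _ "h + s"] by (auto simp: gaps_iff)
  moreover have "- int (Suc m) + int (length \<eta>) = int (Suc m)"
    using assms by simp
  ultimately show ?thesis
    unfolding half.simps gaps_map_Not by (simp only:) blast
qed

text \<open>Induction on the number of rows: the two end lemmas realise \<open>K_op\<close>,
  \<open>num_tilings_row\<close> realises \<open>E_op\<close>, and \<open>half_minus_gaps\<close>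
  realises \<open>R_op\<close>. In the base case two cells remain, tileable exactly when both or
  none are covered.\<close>

lemma C_eq_num_tilings:
  assumes s: "\<bar>s\<bar> = 1" and "length \<eta> = 2 * Suc k"
  shows "C (Suc k) \<eta> = int (num_tilings (gaps (- int (Suc k)) h \<eta> \<union> half s k (h + s)))"
  using assms(2)
proof (induction k arbitrary: \<eta> h)
  case 0
  then obtain a b where "\<eta> = [a, b]"
    by (auto simp: length_Suc_conv numeral_2_eq_2)
  then show ?case
    by (cases a; cases b) (simp_all add: num_tilings_insert pair_in_cell_dominoes)
next
  case (Suc k)
  define Q where "Q = half s (Suc k) (h + s)"
  define c where "c = - int (Suc (Suc k))"
  obtain e e' \<theta> where "\<eta> = e # e' # \<theta>" and \<theta>: "length \<theta> = Suc (Suc (2 * k))"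
    using Suc.prems by (auto simp: length_Suc_conv)
  moreover obtain \<mu> f f' where "\<theta> = \<mu> @ [f, f']"
  proof -
    obtain \<theta>' f' where "\<theta> = \<theta>' @ [f']" "length \<theta>' = Suc (2 * k)"
      using \<theta> by (cases \<theta> rule: rev_cases) auto
    moreover from this obtain \<mu> f where "\<theta>' = \<mu> @ [f]"
      by (cases \<theta>' rule: rev_cases) auto
    ultimately show ?thesis
      using that by simp
  qed
  ultimately have \<eta>: "\<eta> = e # e' # \<mu> @ [f, f']" and \<mu>: "length \<mu> = 2 * k"
    by auto
  have Q: "finite Q" "(x, h) \<notin> Q" "(x, h - s) \<notin> Q" for x
    using half_rows[OF s, of 1 x "h + s"] half_rows[OF s, of 2 x "h + s"]
    by (simp_all add: Q_def finite_half algebra_simps del: half.simps)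
  \<comment> \<open>Hence the end columns \<open>c\<close> and \<open>- c - 1\<close> of the current
    row have no neighbour in the next row, while all other columns do.\<close>
  have inQ: "(x, h + s) \<in> Q \<longleftrightarrow> c + 1 \<le> x \<and> x < - c - 1" for x
  proof -
    have "(x, h + s) \<notin> half s k (h + s + s)"
      using half_rows[OF s, of 1 x "h + s + s" k]
      by (simp only: mult_1 add_diff_cancel_right' simp_thms)
    then show ?thesis
      unfolding Q_def c_def half.simps by auto
  qed
  let ?\<eta>' = "(e \<longrightarrow> e') # \<mu> @ [f' \<longrightarrow> f]"
  have "int (num_tilings (gaps c h \<eta> \<union> Q)) =
      (if \<not> e \<and> e' \<or> f \<and> \<not> f' then 0 else int (num_tilings (gaps (c + 1) h ?\<eta>' \<union> Q)))"
  proof -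
    have L: "num_tilings (gaps c h (e # e' # \<mu> @ [f, f']) \<union> Q) =
        (if \<not> e \<and> e' then 0 else num_tilings (gaps (c + 1) h (((e \<longrightarrow> e') # \<mu>) @ [f, f']) \<union> Q))"
      using num_tilings_left_end[OF s Q, of c e e' "\<mu> @ [f, f']"] inQ by (simp del: gaps.simps)
    have R: "num_tilings (gaps (c + 1) h (((e \<longrightarrow> e') # \<mu>) @ [f, f']) \<union> Q) =
        (if f \<and> \<not> f' then 0 else num_tilings (gaps (c + 1) h (((e \<longrightarrow> e') # \<mu>) @ [f' \<longrightarrow> f]) \<union> Q))"
      by (rule num_tilings_right_end[OF s Q]) (simp add: inQ \<mu> c_def)
    show ?thesis
      unfolding \<eta> L R by simp
  qed
  moreover have "int (num_tilings (gaps (c + 1) h ?\<eta>' \<union> Q)) =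
      row_sum (\<lambda>\<delta>. C (Suc k) (map Not \<delta>)) ?\<eta>'"
  proof -
    have "int (num_tilings (gaps (c + 1) h ?\<eta>' \<union> Q)) =
        row_sum (\<lambda>\<delta>. int (num_tilings (Q - gaps (c + 1) (h + s) \<delta>))) ?\<eta>'"
      by (rule num_tilings_row[OF s Q]) (simp add: inQ \<mu> c_def)
    also have "\<dots> = row_sum (\<lambda>\<delta>. C (Suc k) (map Not \<delta>)) ?\<eta>'"
    proof (rule row_sum_cong)
      fix \<delta> :: "bool list" assume "length \<delta> = length ?\<eta>'"
      then have \<delta>: "length \<delta> = 2 * Suc k"
        using \<mu> by simp
      have c: "c + 1 = - int (Suc k)"
        by (simp add: c_def)
      show "int (num_tilings (Q - gaps (c + 1) (h + s) \<delta>)) = C (Suc k) (map Not \<delta>)"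
        unfolding Q_def c half_minus_gaps[OF s \<delta>] by (rule Suc.IH[symmetric]) (simp add: \<delta>)
    qed
    finally show ?thesis .
  qed
  ultimately show ?case
    unfolding c_def[symmetric] Q_def[symmetric] unfolding \<eta> C_Suc_Suc[OF \<mu>] by simp
qed

section \<open>Gluing the two halves along the cut\<close>

lemma aztec_cells_halves: "aztec_cells n = half 1 n 0 \<union> half (- 1) n (- 1)"
proof -
  have "(x, y) \<in> aztec_cells n \<longleftrightarrow> (x, y) \<in> half 1 n 0 \<union> half (- 1) n (- 1)" for x y
    unfolding Un_iff by (simp add: half_iff aztec_cells_def) (cases "y \<ge> 0"; simp; linarith)
  then show ?thesis
    by auto
qed

text \<open>The rows 0 and -1 adjoin the horizontal axis, and a tiling is determined by the vertical
  dominoes across it and the tilings of what they leave in both halves.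
  \<open>C_eq_num_tilings\<close> covers both directions, so the two factors agree and each term is
  a square.\<close>

lemma num_tilings_aztec_eq_sum:
  "int (num_tilings (aztec_cells (Suc k))) = (\<Sum>\<epsilon>\<in>binseq (2 * Suc k). (C (Suc k) \<epsilon>)\<^sup>2)"
proof -
  let ?n = "int (Suc k)"
  define A where "A = half 1 (Suc k) 0"
  define B where "B = half (- 1) (Suc k) (- 1)"
  define br :: "int \<Rightarrow> cell set" where "br x = {(x, 0), (x, - 1)}" for x
  define P where "P = br ` {- ?n..<?n}"
  \<comment> \<open>Position \<open>i\<close> of the list, counted from 0, stands for the column
    \<open>- ?n + int i\<close>; an entry 1 means that the bridge in this column is used.\<close>
  define X where "X \<epsilon> = {br (- ?n + int i) | i. i < 2 * Suc k \<and> \<epsilon> ! i}" for \<epsilon> :: "bool list"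
  have br_inj: "br x = br y \<longleftrightarrow> x = y" for x y
    by (auto simp: br_def doubleton_eq_iff)
  have inA: "(x, y) \<in> A \<longleftrightarrow> y \<ge> 0 \<and> \<bar>2 * x + 1\<bar> + 2 * y + 1 \<le> 2 * ?n"
    and inB: "(x, y) \<in> B \<longleftrightarrow> y \<le> - 1 \<and> \<bar>2 * x + 1\<bar> + 2 * (- 1 - y) + 1 \<le> 2 * ?n" for x y
    unfolding A_def B_def by (simp_all add: half_iff del: half.simps) linarith+
  have row: "\<bar>2 * x + 1\<bar> + 1 \<le> 2 * ?n \<longleftrightarrow> - ?n \<le> x \<and> x < ?n" for x
    by (cases "x \<ge> 0") auto
  have "num_tilings (A \<union> B) = (\<Sum>Z\<in>Pow P. num_tilings (A - \<Union>Z) * num_tilings (B - \<Union>Z))"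
  proof (rule num_tilings_bridges)
    show "finite A" "finite B"
      by (simp_all only: A_def B_def finite_half)
    show "A \<inter> B = {}"
      using inA inB by auto
    show "P \<subseteq> cell_dominoes"
      by (auto simp: P_def br_def pair_in_cell_dominoes)
    show "disjoint P"
      by (auto simp: P_def br_def disjoint_def)
    show "d \<inter> A \<noteq> {} \<and> d \<inter> B \<noteq> {} \<and> d \<subseteq> A \<union> B" if dP: "d \<in> P" for d
    proof -
      obtain x where x: "d = br x" "- ?n \<le> x" "x < ?n"
        using dP by (auto simp: P_def)
      then have "(x, 0) \<in> A" "(x, - 1) \<in> B"
        unfolding inA inB using row[of x] by auto
      then show ?thesis
        unfolding x br_def by blast
    qed
    show "d \<subseteq> A \<or> d \<subseteq> B \<or> d \<in> P" if d: "d \<in> cell_dominoes" "d \<subseteq> A \<union> B" for d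
    proof -
      have up: "(x, y) \<in> A \<longleftrightarrow> y \<ge> 0" "(x, y) \<in> B \<longleftrightarrow> y < 0" if "(x, y) \<in> A \<union> B" for x y
        using that unfolding Un_iff inA inB by auto
      from d(1) consider i j where "d = {(i, j), (i + 1, j)}" | i j where "d = {(i, j), (i, j + 1)}"
        by (auto simp: cell_dominoes_def)
      then show ?thesis
      proof cases
        case 1
        then show ?thesis
          using up[of i j] up[of "i + 1" j] d(2) by (cases "j \<ge> 0") auto
      next
        case 2
        consider "j \<ge> 0" | "j < - 1" | "j = - 1" by linarith
        then show ?thesis
        proof cases
          case 3
          then have "(i, 0) \<in> A"
            using up[of i 0] 2 d(2) by auto
          then have "d \<in> P"
            using row[of i] 2 3 unfolding inA P_def br_def by (auto simp: insert_commute)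
          then show ?thesis by blast
        qed (use 2 up[of i j] up[of i "j + 1"] d(2) in auto)
      qed
    qed
  qed
  also have "int \<dots> = (\<Sum>\<epsilon>\<in>binseq (2 * Suc k). int (num_tilings (A - \<Union>(X \<epsilon>)) * num_tilings (B - \<Union>(X \<epsilon>))))"
    unfolding of_nat_sum
  proof (rule sum.reindex_bij_witness[where j = "\<lambda>Z. map (\<lambda>i. br (- ?n + int i) \<in> Z) [0..<2 * Suc k]"
        and i = X])
    show XZ: "X (map (\<lambda>i. br (- ?n + int i) \<in> Z) [0..<2 * Suc k]) = Z" if ZP: "Z \<in> Pow P" for Z
    proof -
      have "X (map (\<lambda>i. br (- ?n + int i) \<in> Z) [0..<2 * Suc k]) =
          {br (- ?n + int i) | i. i < 2 * Suc k \<and> br (- ?n + int i) \<in> Z}"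
        unfolding X_def by (intro Collect_cong ex_cong1) (auto simp del: upt_Suc)
      also have "\<dots> = Z"
      proof (intro subset_antisym subsetI)
        fix d assume "d \<in> Z"
        then obtain x where x: "d = br x" "- ?n \<le> x" "x < ?n"
          using ZP by (auto simp: P_def)
        then have "x = - ?n + int (nat (x + ?n))" "nat (x + ?n) < 2 * Suc k"
          by auto
        then show "d \<in> {br (- ?n + int i) | i. i < 2 * Suc k \<and> br (- ?n + int i) \<in> Z}"
          using x \<open>d \<in> Z\<close> by (metis (mono_tags, lifting) mem_Collect_eq)
      qed blast
      finally show ?thesis .
    qed
    show "map (\<lambda>i. br (- ?n + int i) \<in> Z) [0..<2 * Suc k] \<in> binseq (2 * Suc k)" for Z
      by (simp add: binseq_def)
    show "map (\<lambda>i. br (- ?n + int i) \<in> X \<epsilon>) [0..<2 * Suc k] = \<epsilon>" if "\<epsilon> \<in> binseq (2 * Suc k)" for \<epsilon>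
      using that by (intro nth_equalityI) (auto simp: binseq_def X_def br_inj simp del: upt_Suc)
    show "X \<epsilon> \<in> Pow P" for \<epsilon>
      by (auto simp: X_def P_def)
    show "int (num_tilings (A - \<Union>(X (map (\<lambda>i. br (- ?n + int i) \<in> Z) [0..<2 * Suc k]))) *
        num_tilings (B - \<Union>(X (map (\<lambda>i. br (- ?n + int i) \<in> Z) [0..<2 * Suc k])))) =
        int (num_tilings (A - \<Union>Z) * num_tilings (B - \<Union>Z))" if "Z \<in> Pow P" for Z
      unfolding XZ[OF that] ..
  qed
  also have "\<dots> = (\<Sum>\<epsilon>\<in>binseq (2 * Suc k). (C (Suc k) \<epsilon>)\<^sup>2)"
  proof (rule sum.cong[OF refl])
    fix \<epsilon> assume "\<epsilon> \<in> binseq (2 * Suc k)"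
    then have len: "length \<epsilon> = 2 * Suc k"
      by (simp add: binseq_def)
    \<comment> \<open>In either row at the cut, the bridges cover the cells with entry 1, which are
      the gaps of the complementary sequence. Subtracting them from a half complements once more and
      leaves the gaps of \<open>\<epsilon>\<close>.\<close>
    have UX: "(x, y) \<in> \<Union>(X \<epsilon>) \<longleftrightarrow> (y = 0 \<or> y = - 1) \<and> (x, y) \<in> gaps (- ?n) y (map Not \<epsilon>)" for x y
    proof -
      have "(x, y) \<in> \<Union>(X \<epsilon>) \<longleftrightarrow> (y = 0 \<or> y = - 1) \<and> (\<exists>i < 2 * Suc k. x = - ?n + int i \<and> \<epsilon> ! i)"
        unfolding X_def br_def by auto
      also have "(\<exists>i < 2 * Suc k. x = - ?n + int i \<and> \<epsilon> ! i) \<longleftrightarrow>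
          - ?n \<le> x \<and> x < - ?n + int (length \<epsilon>) \<and> \<epsilon> ! nat (x - - ?n)"
      proof
        assume "- ?n \<le> x \<and> x < - ?n + int (length \<epsilon>) \<and> \<epsilon> ! nat (x - - ?n)"
        then show "\<exists>i < 2 * Suc k. x = - ?n + int i \<and> \<epsilon> ! i"
          using len by (intro exI[of _ "nat (x - - ?n)"]) auto
      qed (auto simp: len)
      also have "\<dots> \<longleftrightarrow> (x, y) \<in> gaps (- ?n) y (map Not \<epsilon>)"
      proof -
        have "nat (x - - ?n) < length \<epsilon>" if "- ?n \<le> x" "x < - ?n + int (length \<epsilon>)"
          using that by linarith
        then show ?thesis
          by (auto simp: gaps_iff)
      qed
      finally show ?thesis .
    qed
    have NN: "map Not (map Not \<epsilon>) = \<epsilon>"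
      by (simp add: comp_def)
    have "A - \<Union>(X \<epsilon>) = A - gaps (- ?n) 0 (map Not \<epsilon>)"
    proof -
      have "(x, y) \<in> \<Union>(X \<epsilon>) \<longleftrightarrow> (x, y) \<in> gaps (- ?n) 0 (map Not \<epsilon>)" if "(x, y) \<in> A" for x y
        using that unfolding inA UX gaps_iff by auto
      then show ?thesis
        by auto
    qed
    also have "\<dots> = gaps (- ?n) 0 \<epsilon> \<union> half 1 k (0 + 1)"
      unfolding A_def by (subst half_minus_gaps) (simp_all only: NN length_map len abs_one)
    finally have CA: "int (num_tilings (A - \<Union>(X \<epsilon>))) = C (Suc k) \<epsilon>"
      using C_eq_num_tilings[of 1 \<epsilon> k 0] len by simp
    have "B - \<Union>(X \<epsilon>) = B - gaps (- ?n) (- 1) (map Not \<epsilon>)"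
    proof -
      have "(x, y) \<in> \<Union>(X \<epsilon>) \<longleftrightarrow> (x, y) \<in> gaps (- ?n) (- 1) (map Not \<epsilon>)" if "(x, y) \<in> B" for x y
        using that unfolding inB UX gaps_iff by auto
      then show ?thesis
        by auto
    qed
    also have "\<dots> = gaps (- ?n) (- 1) \<epsilon> \<union> half (- 1) k (- 1 + - 1)"
      unfolding B_def by (subst half_minus_gaps) (simp_all only: NN length_map len abs_one abs_minus_cancel)
    finally have CB: "int (num_tilings (B - \<Union>(X \<epsilon>))) = C (Suc k) \<epsilon>"
      using C_eq_num_tilings[of "- 1" \<epsilon> k "- 1"] len by simp
    show "int (num_tilings (A - \<Union>(X \<epsilon>)) * num_tilings (B - \<Union>(X \<epsilon>))) = (C (Suc k) \<epsilon>)\<^sup>2"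
      by (simp only: of_nat_mult CA CB power2_eq_square)
  qed
  finally show ?thesis
    by (simp only: aztec_cells_halves A_def B_def)
qed

theorem theorem3:
  fixes n :: nat
  assumes "n \<ge> 1"
  shows "l2_norm (2 * n) (C n) = int (card (domino_tilings (aztec_diamond n)))
       \<and> l2_norm (2 * n) (C n) = 2 ^ (n * (n + 1) div 2)"
proof -
  obtain k where n: "n = Suc k"
    using assms by (cases n) auto
  have "l2_norm (2 * n) (C n) = int (num_tilings (aztec_cells n))"
    unfolding l2_norm_def n num_tilings_aztec_eq_sum ..
  moreover have "card (domino_tilings (aztec_diamond n)) = num_tilings (aztec_cells n)"
    unfolding aztec_diamond_eq by (rule card_domino_tilings[OF finite_aztec_cells])
  ultimately show ?thesis
    by (simp add: num_tilings_aztec)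
qed

end
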